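(* If $f\in W^{1,1}_{\rm loc}(\mathbb{R}^n)$, then $$Tf(x)=\Big(\int_0^\infty \big|\phi_t*\nabla f(x)\big|^2\frac{dt}{t}\Big)^{1/2}=\frac{1}{n\omega_n}\Big(\int_0^\infty\Big|\int_{|y|\leq t} \frac{y}{|y|^n}\cdot\nabla f(x-y)\, dy\Big|^2\frac{dt}{t^3}\Big)^{1/2}$$ for almost all $x\in\mathbb{R}^n$.
   Context: Here $n\ge1$ and $\omega_n$ is the volume of the unit ball in $\mathbb{R}^n$. $f_{S(x,t)}$ is the average of (the trace of) $f$ over the sphere $S(x,t)$ of center $x$ and radius $t$ with respect to surface measure (for $n=1$, $f_{S(x,t)}=\frac{f(x+t)+f(x-t)}{2}$), and $$Tf(x)=\Big(\int_0^\infty \big|f(x)-f_{S(x,t)}\big|^2\,\frac{dt}{t^3}\Big)^{1/2}\in[0,\infty].$$ The function $\phi:\mathbb{R}^n\to\mathbb{R}^n$ is $\phi(x)=\frac{1}{n\omega_n}\frac{x}{|x|^n}\chi_{B(0,1)}(x)$, and $\phi_t(x)=t^{-n}\phi(x/t)=\frac{1}{t\,n\omega_n}\frac{x}{|x|^n}\chi_{B(0,t)}(x)$ for $t>0$. The convolution is taken with the scalar product: $\phi_t*\nabla f(x)=\int_{\mathbb{R}^n}\phi_t(y)\cdot\nabla f(x-y)\,dy$. $W^{1,1}_{\rm loc}(\mathbb{R}^n)$ is the space of locally integrable functions with locally integrable first order weak derivatives. *)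

theory Defs
  imports "HOL-Analysis.Analysis"
begin

section \<open>The space $W^{1,1}_{loc}$\<close>

definition locally_integrable :: "('a::euclidean_space \<Rightarrow> 'b::euclidean_space) \<Rightarrow> bool" where
  "locally_integrable f \<longleftrightarrow> (\<forall>K. compact K \<longrightarrow> f absolutely_integrable_on K)"

definition partial_deriv :: "'a::euclidean_space \<Rightarrow> ('a \<Rightarrow> real) \<Rightarrow> 'a \<Rightarrow> real" where
  "partial_deriv b u x = frechet_derivative u (at x) b"

definition gradient :: "('a::euclidean_space \<Rightarrow> real) \<Rightarrow> 'a \<Rightarrow> 'a" where
  "gradient u x = (\<Sum>b\<in>Basis. partial_deriv b u x *\<^sub>R b)"

primrec continuously_differentiable :: "nat \<Rightarrow> ('a::euclidean_space \<Rightarrow> real) \<Rightarrow> bool" where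
  "continuously_differentiable 0 u \<longleftrightarrow> continuous_on UNIV u"
| "continuously_differentiable (Suc k) u \<longleftrightarrow>
     (\<forall>x. u differentiable (at x)) \<and> (\<forall>b\<in>Basis. continuously_differentiable k (partial_deriv b u))"

definition smooth :: "('a::euclidean_space \<Rightarrow> real) \<Rightarrow> bool" where
  "smooth u \<longleftrightarrow> (\<forall>k. continuously_differentiable k u)"

definition test_function :: "('a::euclidean_space \<Rightarrow> real) \<Rightarrow> bool" where
  "test_function u \<longleftrightarrow> smooth u \<and> compact (closure {x. u x \<noteq> 0})"

text \<open>The weak gradient is a relation, since it is determined only up to a null set.\<close>

definition has_weak_gradient :: "('a::euclidean_space \<Rightarrow> real) \<Rightarrow> ('a \<Rightarrow> 'a) \<Rightarrow> bool" where
  "has_weak_gradient f G \<longleftrightarrow> locally_integrable G \<and>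
     (\<forall>u. test_function u \<longrightarrow> (\<forall>b\<in>Basis.
        (LINT x|lebesgue. f x * partial_deriv b u x) = - (LINT x|lebesgue. (G x \<bullet> b) * u x)))"

definition W11_loc :: "('a::euclidean_space \<Rightarrow> real) set" where
  "W11_loc = {f. locally_integrable f \<and> (\<exists>G. has_weak_gradient f G)}"


section \<open>Averages of traces over spheres\<close>

text \<open>
  Surface measure on the sphere of center \<open>x\<close> and radius \<open>t > 0\<close>, as a Borel measure on the whole
  space. As in the polar coordinates theorem, the surface measure of \<open>A\<close> is \<open>n / t\<close> times the volume
  of the cone \<open>{x + s (y - x) | y \<in> A, 0 < s \<le> 1}\<close> with apex \<open>x\<close> over \<open>A\<close>; this cone is the preimage
  of \<open>A\<close> under the radial projection of the punctured ball onto the sphere. For \<open>n = 1\<close> it is the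
  counting measure on \<open>{x - t, x + t}\<close>.
\<close>

definition sphere_measure :: "'a::euclidean_space \<Rightarrow> real \<Rightarrow> 'a measure" where
  "sphere_measure x t = scale_measure (ennreal (real DIM('a) / t))
     (distr (restrict_space lborel (cball x t - {x})) borel (\<lambda>y. x + t *\<^sub>R sgn (y - x)))"

lemma emeasure_sphere_measure_cone:
  fixes x :: "'a::euclidean_space"
  assumes t: "t > 0" and A: "A \<in> sets borel" "A \<subseteq> sphere x t"
  shows "emeasure (sphere_measure x t) A =
    ennreal (real DIM('a) / t) * emeasure lborel {x + s *\<^sub>R (y - x) | s y. y \<in> A \<and> 0 < s \<and> s \<le> 1}"
proof -
  let ?D = "cball x t - {x}" and ?p = "\<lambda>y. x + t *\<^sub>R sgn (y - x)"
  have D: "?D \<in> sets lborel" by simp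
  have p: "?p \<in> measurable (restrict_space lborel ?D) borel"
    by (intro measurable_restrict_space1) measurable
  have eq: "?p -` A \<inter> ?D = {x + s *\<^sub>R (y - x) | s y. y \<in> A \<and> 0 < s \<and> s \<le> 1}"
  proof (intro equalityI subsetI)
    fix z assume z: "z \<in> ?p -` A \<inter> ?D"
    then have nz: "norm (z - x) > 0" "norm (z - x) \<le> t" by (auto simp: dist_norm norm_minus_commute)
    have "z = x + (norm (z - x) / t) *\<^sub>R (?p z - x)" using nz t by (simp add: sgn_div_norm)
    moreover have "0 < norm (z - x) / t" "norm (z - x) / t \<le> 1" using nz t by auto
    moreover have "?p z \<in> A" using z by simp
    ultimately show "z \<in> {x + s *\<^sub>R (y - x) | s y. y \<in> A \<and> 0 < s \<and> s \<le> 1}" by blast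
  next
    fix z assume "z \<in> {x + s *\<^sub>R (y - x) | s y. y \<in> A \<and> 0 < s \<and> s \<le> 1}"
    then obtain s y where z: "z = x + s *\<^sub>R (y - x)" "y \<in> A" "0 < s" "s \<le> 1" by blast
    have n: "norm (y - x) = t" using z A by (auto simp: dist_norm norm_minus_commute)
    have "sgn (z - x) = (1 / t) *\<^sub>R (y - x)"
      unfolding z(1) add_diff_cancel_left' sgn_scaleR using z(3) n
      by (simp add: sgn_div_norm divide_inverse)
    then have "?p z = y" using t by simp
    moreover have "z \<in> cball x t" using z n t by (simp add: dist_norm mult_le_cancel_right2)
    moreover have "z \<noteq> x" using z n t by auto
    ultimately show "z \<in> ?p -` A \<inter> ?D" using z by simp
  qed
  have "emeasure (sphere_measure x t) A =
      ennreal (real DIM('a) / t) * emeasure (restrict_space lborel ?D) (?p -` A \<inter> ?D)"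
    unfolding sphere_measure_def by (subst emeasure_scale_measure, subst emeasure_distr[OF p])
      (use A in \<open>auto simp: space_restrict_space\<close>)
  also have "emeasure (restrict_space lborel ?D) (?p -` A \<inter> ?D) = emeasure lborel (?p -` A \<inter> ?D)"
    by (rule emeasure_restrict_space) (use D in auto)
  finally show ?thesis unfolding eq .
qed

lemma emeasure_sphere_measure_total:
  fixes x :: "'a::euclidean_space"
  assumes t: "t > 0"
  shows "emeasure (sphere_measure x t) UNIV =
    ennreal (real DIM('a) * measure lborel (ball (0::'a) 1) * t ^ (DIM('a) - 1))"
proof -
  let ?D = "cball x t - {x}" and ?p = "\<lambda>y. x + t *\<^sub>R sgn (y - x)"
  have p: "?p \<in> measurable (restrict_space lborel ?D) borel"
    by (intro measurable_restrict_space1) measurable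
  have "emeasure (sphere_measure x t) UNIV =
      ennreal (real DIM('a) / t) * emeasure (restrict_space lborel ?D) ?D"
    unfolding sphere_measure_def by (subst emeasure_scale_measure, subst emeasure_distr[OF p])
      (auto simp: space_restrict_space)
  also have "emeasure (restrict_space lborel ?D) ?D = emeasure lborel (cball x t)"
    by (subst emeasure_restrict_space) (auto intro!: emeasure_Diff_null_set)
  also have "\<dots> = ennreal (measure lborel (ball (0::'a) 1) * t ^ DIM('a))"
    using t by (simp add: emeasure_cball measure_def emeasure_ball)
  also have "ennreal (real DIM('a) / t) * \<dots> =
      ennreal (real DIM('a) * measure lborel (ball (0::'a) 1) * t ^ (DIM('a) - 1))"
    using t by (subst ennreal_mult[symmetric])
      (auto simp: field_simps power_eq_if[of t "DIM('a)"])
  finally show ?thesis .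
qed

text \<open>
  \<open>h\<close> is the trace of \<open>f\<close> on the sphere: it is the limit, in \<open>L\<^sup>1\<close> of the sphere, of the restrictions
  to the sphere of functions that are smooth up to the boundary of the ball and converge to \<open>f\<close> in
  \<open>W\<^sup>1\<^sup>,\<^sup>1\<close> of the ball. The trace theorem says that, for \<open>f\<close> in \<open>W11_loc\<close> and \<open>t > 0\<close>, it exists and is
  determined up to a null set of the sphere.
\<close>

definition has_trace_on_sphere ::
    "('a::euclidean_space \<Rightarrow> real) \<Rightarrow> 'a \<Rightarrow> real \<Rightarrow> ('a \<Rightarrow> real) \<Rightarrow> bool" where
  "has_trace_on_sphere f x t h \<longleftrightarrow> integrable (sphere_measure x t) h \<and>
     (\<exists>G u. has_weak_gradient f G \<and> (\<forall>k::nat. smooth (u k)) \<and>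
        (\<lambda>k. \<integral>\<^sup>+y\<in>ball x t. ennreal \<bar>u k y - f y\<bar> \<partial>lebesgue) \<longlonglongrightarrow> 0 \<and>
        (\<lambda>k. \<integral>\<^sup>+y\<in>ball x t. ennreal (norm (gradient (u k) y - G y)) \<partial>lebesgue) \<longlonglongrightarrow> 0 \<and>
        (\<lambda>k. \<integral>\<^sup>+y. ennreal \<bar>u k y - h y\<bar> \<partial>sphere_measure x t) \<longlonglongrightarrow> 0)"

definition sphere_trace :: "('a::euclidean_space \<Rightarrow> real) \<Rightarrow> 'a \<Rightarrow> real \<Rightarrow> 'a \<Rightarrow> real" where
  "sphere_trace f x t = (SOME h. has_trace_on_sphere f x t h)"

definition sphere_average :: "('a::euclidean_space \<Rightarrow> real) \<Rightarrow> 'a \<Rightarrow> real \<Rightarrow> real" where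
  "sphere_average f x t =
     (LINT y|sphere_measure x t. sphere_trace f x t y) / measure (sphere_measure x t) UNIV"


section \<open>The square function and the kernel\<close>

definition ennreal_sqrt :: "ennreal \<Rightarrow> ennreal" where
  "ennreal_sqrt a = (if a = \<infinity> then \<infinity> else ennreal (sqrt (enn2real a)))"

definition square_fun :: "('a::euclidean_space \<Rightarrow> real) \<Rightarrow> 'a \<Rightarrow> ennreal" where
  "square_fun f x =
     ennreal_sqrt (\<integral>\<^sup>+t\<in>{0<..}. ennreal (\<bar>f x - sphere_average f x t\<bar>\<^sup>2 / t ^ 3) \<partial>lborel)"

definition phi :: "'a::euclidean_space \<Rightarrow> 'a" where
  "phi x = (1 / (real DIM('a) * measure lborel (ball (0::'a) 1))) *\<^sub>R
     (indicator (ball 0 1) x *\<^sub>R ((1 / norm x ^ DIM('a)) *\<^sub>R x))"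

definition dilate :: "('a::euclidean_space \<Rightarrow> 'a) \<Rightarrow> real \<Rightarrow> 'a \<Rightarrow> 'a" where
  "dilate F t x = (1 / t ^ DIM('a)) *\<^sub>R F ((1 / t) *\<^sub>R x)"

definition inner_convolution :: "('a::euclidean_space \<Rightarrow> 'a) \<Rightarrow> ('a \<Rightarrow> 'a) \<Rightarrow> 'a \<Rightarrow> real" where
  "inner_convolution F G x = (LINT y|lebesgue. F y \<bullet> G (x - y))"

end

theory Submission
  imports Defs "HOL-Real_Asymp.Real_Asymp"
begin

text \<open>
  For smooth \<open>u\<close>, integrating \<open>\<nabla>u(x + sy) \<bullet> y\<close> over \<open>s \<in> (a, t/|y|)\<close> and \<open>y\<close> in the ball of radius \<open>t\<close>
  compares the values of \<open>u\<close> on the sphere with \<open>u(x + ay)\<close>. The substitution \<open>z = sy\<close> turns the double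
  integral into a weighted integral over the ball: \<open>a = 0\<close> gives the representation
  \<open>u(x) - u\<^bsub>S(x,t)\<^esub> = t (\<phi>\<^sub>t * \<nabla>u)(x)\<close>, and \<open>a = 1\<close> bounds the \<open>L\<^sup>1\<close> norm on the sphere by the \<open>W\<^sup>1\<^sup>,\<^sup>1\<close> norm on
  the ball, so that traces exist and their averages are unique. Take mollifications \<open>u\<^sub>k\<close> of \<open>f\<close> converging
  so fast that \<open>\<Sum>|u\<^sub>k - f|\<close> and \<open>\<Sum>|\<nabla>u\<^sub>k - \<nabla>f|\<close>, each term cut off to the ball of radius \<open>k\<close>, are
  integrable. The convolution of the second sum with the integrable kernel \<open>|y|\<^bsup>1-n\<^esup>\<close> on each ball is
  finite almost everywhere, so outside one null set, independent of \<open>t\<close>, the representation passes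
  to the limit.
\<close>

section \<open>Smooth functions and bump functions\<close>

text \<open>\<open>sphere_trace\<close> is chosen by \<open>SOME\<close>, so nothing may depend on
  the choice: a trace comes with a weak gradient and a smooth sequence of its own, and both must be
  compared with the fixed ones. Hence the uniqueness of the weak gradient and the estimate for the
  difference of two approximations. The surface measure is an image of Lebesgue measure on the ball,
  so an integral over the sphere is an integral over the ball of a function constant on rays, and
  Fubini on ball times line does the work of polar coordinates. For n >= 2 the kernel is unbounded
  at 0, so L^1 convergence of the gradients on balls says nothing at a given point; the rate 2^(-k)
  makes the convolved errors summable at almost every point. Only integer radii enter the
  exceptional set, since a larger ball controls every smaller t. Measurability in t is never proved:
  the square functions are compared integrand by integrand.\<close>

lemma smooth_differentiable:
  assumes "smooth u"
  shows "u differentiable (at x)"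
  using assms unfolding smooth_def by (metis continuously_differentiable.simps(2))

lemma smooth_partial_deriv:
  assumes "smooth u" "b \<in> Basis"
  shows "smooth (partial_deriv b u)"
  using assms unfolding smooth_def by (metis continuously_differentiable.simps(2))

lemma smooth_continuous_on:
  assumes "smooth u"
  shows "continuous_on S u"
  using assms unfolding smooth_def
  by (metis continuously_differentiable.simps(1) continuous_on_subset subset_UNIV)

lemma gradient_inner_eq:
  fixes u :: "'a::euclidean_space \<Rightarrow> real"
  assumes "u differentiable (at x)"
  shows "frechet_derivative u (at x) h = gradient u x \<bullet> h"
proof -
  interpret bounded_linear "frechet_derivative u (at x)"
    using assms frechet_derivative_works has_derivative_bounded_linear by blast
  have "frechet_derivative u (at x) h = frechet_derivative u (at x) (\<Sum>b\<in>Basis. (h \<bullet> b) *\<^sub>R b)"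
    by (simp add: euclidean_representation)
  also have "\<dots> = gradient u x \<bullet> h"
    by (simp add: sum scaleR gradient_def partial_deriv_def inner_sum_left inner_commute[of h] mult.commute)
  finally show ?thesis .
qed

lemma has_derivative_gradient:
  fixes u :: "'a::euclidean_space \<Rightarrow> real"
  assumes "u differentiable (at x)"
  shows "(u has_derivative (\<lambda>h. gradient u x \<bullet> h)) (at x)"
proof -
  have "frechet_derivative u (at x) = (\<lambda>h. gradient u x \<bullet> h)"
    using gradient_inner_eq[OF assms] by blast
  then show ?thesis using assms by (simp add: frechet_derivative_works)
qed

lemma partial_deriv_eq:
  assumes "(u has_derivative D) (at x)"
  shows "partial_deriv b u x = D b"
  using frechet_derivative_at[OF assms] by (simp add: partial_deriv_def)

lemma inner_gradient_Basis:
  assumes "b \<in> Basis"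
  shows "gradient u x \<bullet> b = partial_deriv b u x"
  using assms by (simp add: gradient_def)

lemma continuous_on_gradient:
  assumes "smooth u"
  shows "continuous_on S (gradient u)"
  unfolding gradient_def
  by (intro continuous_intros smooth_continuous_on smooth_partial_deriv assms)

lemma DERIV_along_line:
  fixes u :: "'a::euclidean_space \<Rightarrow> real"
  assumes u: "smooth u"
  shows "((\<lambda>s. u (x + s *\<^sub>R y)) has_real_derivative gradient u (x + s *\<^sub>R y) \<bullet> y) (at s)"
proof -
  have "((\<lambda>s. x + s *\<^sub>R y) has_derivative (\<lambda>h. h *\<^sub>R y)) (at s)"
    by (auto intro!: derivative_eq_intros)
  from has_derivative_compose[OF this has_derivative_gradient[OF smooth_differentiable[OF u]]]
  have "((\<lambda>s. u (x + s *\<^sub>R y)) has_derivative (\<lambda>h. h * (gradient u (x + s *\<^sub>R y) \<bullet> y))) (at s)" by simp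
  then show ?thesis
    unfolding has_field_derivative_def by (rule has_derivative_eq_rhs) (simp add: fun_eq_iff)
qed

text \<open>Needed to apply the trace inequality to the difference of two approximations. The
  induction ranges over all pairs, because differentiation replaces a pair by the pair of its
  partial derivatives.\<close>

lemma smooth_diff:
  assumes "smooth u" "smooth v"
  shows "smooth (\<lambda>x. u x - v x)"
proof -
  have "continuously_differentiable k (\<lambda>x. u x - v x)"
    if "smooth u" "smooth v" for k and u v :: "'a \<Rightarrow> real"
    using that
  proof (induction k arbitrary: u v)
    case 0
    then show ?case by (simp add: continuous_on_diff smooth_continuous_on)
  next
    case (Suc k)
    have "(\<lambda>x. u x - v x) differentiable (at x)" for x
      by (intro differentiable_diff smooth_differentiable Suc.prems)
    moreover have "partial_deriv b (\<lambda>x. u x - v x) = (\<lambda>x. partial_deriv b u x - partial_deriv b v x)"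
      for b
    proof
      fix x
      show "partial_deriv b (\<lambda>x. u x - v x) x = partial_deriv b u x - partial_deriv b v x"
        using Suc.prems[THEN smooth_differentiable, of x]
        by (subst partial_deriv_eq[OF has_derivative_diff[OF has_derivative_gradient has_derivative_gradient]])
          (auto simp: gradient_inner_eq[symmetric] partial_deriv_def)
    qed
    moreover have "continuously_differentiable k (\<lambda>x. partial_deriv b u x - partial_deriv b v x)"
      if "b \<in> Basis" for b
      by (rule Suc.IH) (use Suc.prems that smooth_partial_deriv in auto)
    ultimately show ?case by simp
  qed
  then show ?thesis using assms unfolding smooth_def by blast
qed

lemma gradient_diff:
  assumes "smooth u" "smooth v"
  shows "gradient (\<lambda>x. u x - v x) x = gradient u x - gradient v x"
proof -
  have "partial_deriv b (\<lambda>x. u x - v x) x = partial_deriv b u x - partial_deriv b v x" for b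
    using assms[THEN smooth_differentiable, of x]
    by (subst partial_deriv_eq[OF has_derivative_diff[OF has_derivative_gradient has_derivative_gradient]])
      (auto simp: gradient_inner_eq[symmetric] partial_deriv_def)
  then show ?thesis by (simp add: gradient_def sum_subtractf scaleR_diff_left)
qed

lemma has_derivative_reflect:
  fixes u :: "'a::euclidean_space \<Rightarrow> real"
  assumes "u differentiable (at (x - y))"
  shows "((\<lambda>y. c * u (x - y)) has_derivative (\<lambda>h. - c * (gradient u (x - y) \<bullet> h))) (at y)"
proof -
  have "((\<lambda>y. x - y) has_derivative (\<lambda>h. - h)) (at y)"
    by (auto intro!: derivative_eq_intros)
  from has_derivative_compose[OF this has_derivative_gradient[OF assms]]
  show ?thesis by (auto intro!: derivative_eq_intros)
qed

lemma partial_deriv_reflect: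
  fixes u :: "'a::euclidean_space \<Rightarrow> real"
  assumes "smooth u" "b \<in> Basis"
  shows "partial_deriv b (\<lambda>y. c * u (x - y)) = (\<lambda>y. (- c) * partial_deriv b u (x - y))"
  by (rule ext, subst partial_deriv_eq[OF has_derivative_reflect])
    (use assms in \<open>auto simp: smooth_differentiable inner_gradient_Basis\<close>)

text \<open>Makes a reflected mollifier an admissible test function. The factor \<open>c\<close> is
  generalised in the induction because every differentiation flips its sign.\<close>

lemma smooth_reflect:
  fixes u :: "'a::euclidean_space \<Rightarrow> real"
  assumes "smooth u"
  shows "smooth (\<lambda>y. c * u (x - y))"
proof -
  have "continuously_differentiable k (\<lambda>y. c * u (x - y))"
    if "smooth u" for k and u :: "'a \<Rightarrow> real" and c
    using that
  proof (induction k arbitrary: u c)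
    case 0
    have "continuous_on UNIV (\<lambda>y. u (x - y))"
      by (rule continuous_on_compose2[OF smooth_continuous_on[OF 0, of UNIV]]) (auto intro!: continuous_intros)
    then show ?case by (auto intro!: continuous_intros)
  next
    case (Suc k)
    have "(\<lambda>y. c * u (x - y)) differentiable (at y)" for y
      using has_derivative_reflect[OF smooth_differentiable[OF Suc.prems]] differentiableI by blast
    moreover have "continuously_differentiable k (partial_deriv b (\<lambda>y. c * u (x - y)))"
      if "b \<in> Basis" for b
      unfolding partial_deriv_reflect[OF Suc.prems that]
      by (rule Suc.IH) (use Suc.prems that smooth_partial_deriv in auto)
    ultimately show ?case by simp
  qed
  then show ?thesis using assms unfolding smooth_def by blast
qed

section \<open>Bump functions and mollifiers\<close>

definition bump_profile :: "nat \<Rightarrow> real \<Rightarrow> real" where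
  "bump_profile k s = (if s > 0 then exp (- 1 / s) / s ^ k else 0)"

lemma bump_profile_tendsto_0: "bump_profile k \<midarrow>0\<rightarrow> 0"
proof -
  have "(bump_profile k \<longlongrightarrow> 0) (at_right 0)"
  proof (rule Lim_transform_eventually)
    show "((\<lambda>s. exp (- 1 / s) / s ^ k) \<longlongrightarrow> 0) (at_right (0::real))"
      by real_asymp
    show "\<forall>\<^sub>F s in at_right 0. exp (- 1 / s) / s ^ k = bump_profile k s"
      using eventually_at_right_less[of "0::real"] by eventually_elim (simp add: bump_profile_def)
  qed
  moreover have "(bump_profile k \<longlongrightarrow> 0) (at_left 0)"
  proof (rule tendsto_eventually)
    show "\<forall>\<^sub>F s in at_left 0. bump_profile k s = 0"
      by (rule eventually_at_leftI[of "-1"]) (auto simp: bump_profile_def)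
  qed
  ultimately show ?thesis by (simp add: filterlim_split_at)
qed

text \<open>The exponential contributes s^(-2) and the power -k s^(-1), so the profiles for all
  \<open>k\<close> form a family closed under differentiation up to linear combinations. At 0 the
  difference quotient of profile \<open>k\<close> is profile \<open>k + 1\<close>, which tends to
  0.\<close>

lemma DERIV_bump_profile:
  "DERIV (bump_profile k) s :> bump_profile (k + 2) s - k * bump_profile (k + 1) s"
proof -
  consider "s > 0" | "s < 0" | "s = 0" by linarith
  then show ?thesis
  proof cases
    case 1
    have "DERIV (\<lambda>s. exp (- 1 / s) / s ^ k) s :> bump_profile (k + 2) s - k * bump_profile (k + 1) s"
      using 1
      apply (auto intro!: derivative_eq_intros simp: bump_profile_def)
      apply (cases k; simp add: field_simps power2_eq_square)
      done
    then show ?thesis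
      by (rule has_field_derivative_transform_within_open[where S="{0<..}"])
        (use 1 in \<open>auto simp: bump_profile_def\<close>)
  next
    case 2
    have "DERIV (\<lambda>s. 0) s :> bump_profile (k + 2) s - k * bump_profile (k + 1) s"
      using 2 by (simp add: bump_profile_def)
    then show ?thesis
      by (rule has_field_derivative_transform_within_open[where S="{..<0}"])
        (use 2 in \<open>auto simp: bump_profile_def\<close>)
  next
    case 3
    have "(\<lambda>h. (bump_profile k (0 + h) - bump_profile k 0) / h) \<midarrow>0\<rightarrow> 0"
    proof (rule Lim_transform_eventually[OF bump_profile_tendsto_0[of "Suc k"]])
      show "\<forall>\<^sub>F h in at 0. bump_profile (Suc k) h = (bump_profile k (0 + h) - bump_profile k 0) / h"
        unfolding eventually_at_filter by (auto simp: bump_profile_def field_simps)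
    qed
    then show ?thesis using 3 by (simp add: DERIV_def bump_profile_def)
  qed
qed

text \<open>The generators are chosen so that the algebra is closed under partial derivatives.\<close>

inductive_set bump_algebra :: "real \<Rightarrow> ('a::euclidean_space \<Rightarrow> real) set" for r where
  const: "(\<lambda>x. c) \<in> bump_algebra r"
| coord: "(\<lambda>x. x \<bullet> b) \<in> bump_algebra r"
| bump: "(\<lambda>x. bump_profile k (r\<^sup>2 - x \<bullet> x)) \<in> bump_algebra r"
| add: "u \<in> bump_algebra r \<Longrightarrow> v \<in> bump_algebra r \<Longrightarrow> (\<lambda>x. u x + v x) \<in> bump_algebra r"
| mult: "u \<in> bump_algebra r \<Longrightarrow> v \<in> bump_algebra r \<Longrightarrow> (\<lambda>x. u x * v x) \<in> bump_algebra r"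

text \<open>The step that iterates to smoothness. The derivative is carried as a function
  \<open>D x\<close> together with the membership of its directional values, so that the sum and
  product rules preserve both.\<close>

lemma bump_algebra_deriv:
  fixes u :: "'a::euclidean_space \<Rightarrow> real"
  assumes "u \<in> bump_algebra r"
  shows "\<exists>D. (\<forall>x. (u has_derivative D x) (at x)) \<and> (\<forall>b. (\<lambda>x. D x b) \<in> bump_algebra r)"
  using assms
proof induction
  case (const c)
  show ?case
    by (intro exI[of _ "\<lambda>x h. 0"]) (auto intro: bump_algebra.const)
next
  case (coord b)
  show ?case
    by (intro exI[of _ "\<lambda>x h. h \<bullet> b"]) (auto intro!: derivative_eq_intros bump_algebra.const)
next
  case (bump k)
  \<comment> \<open>Only sums, products and constants occur, with minus signs absorbed into
    constants, so that the introduction rules of \<open>bump_algebra\<close> prove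
    membership.\<close>
  let ?D = "\<lambda>(x::'a) h. (bump_profile (k + 2) (r\<^sup>2 - x \<bullet> x) + (- real k) * bump_profile (k + 1) (r\<^sup>2 - x \<bullet> x))
     * ((- 2) * (x \<bullet> h))"
  have "((\<lambda>x. bump_profile k (r\<^sup>2 - x \<bullet> x)) has_derivative ?D x) (at x)" for x :: 'a
  proof -
    have "((\<lambda>x::'a. r\<^sup>2 - x \<bullet> x) has_derivative (\<lambda>h. (- 2) * (x \<bullet> h))) (at x)"
      by (auto intro!: derivative_eq_intros simp: inner_commute)
    from has_derivative_compose[OF this DERIV_bump_profile[of k, unfolded has_field_derivative_def]]
    show ?thesis by simp
  qed
  moreover have "(\<lambda>x. ?D x b) \<in> bump_algebra r" for b
    by (intro bump_algebra.intros)
  ultimately show ?case by (intro exI[of _ ?D]) blast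
next
  case (add u v)
  then obtain D E where "\<forall>x. (u has_derivative D x) (at x)" "\<forall>b. (\<lambda>x. D x b) \<in> bump_algebra r"
    "\<forall>x. (v has_derivative E x) (at x)" "\<forall>b. (\<lambda>x. E x b) \<in> bump_algebra r" by blast
  then show ?case
    by (intro exI[of _ "\<lambda>x h. D x h + E x h"]) (auto intro!: derivative_intros bump_algebra.add)
next
  case (mult u v)
  then obtain D E where "\<forall>x. (u has_derivative D x) (at x)" "\<forall>b. (\<lambda>x. D x b) \<in> bump_algebra r"
    "\<forall>x. (v has_derivative E x) (at x)" "\<forall>b. (\<lambda>x. E x b) \<in> bump_algebra r" by blast
  with mult.hyps show ?case
    by (intro exI[of _ "\<lambda>x h. u x * E x h + D x h * v x"])
      (auto intro!: derivative_intros bump_algebra.add bump_algebra.mult)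
qed

lemma bump_algebra_smooth:
  assumes "u \<in> bump_algebra r"
  shows "smooth u"
proof -
  have "continuously_differentiable k u" if "u \<in> bump_algebra r" for k u
    using that
  proof (induction k arbitrary: u)
    case 0
    then show ?case
      using bump_algebra_deriv[of u r]
      by (auto intro!: continuous_at_imp_continuous_on intro: has_derivative_continuous)
  next
    case (Suc k)
    then obtain D where D: "\<forall>x. (u has_derivative D x) (at x)" "\<forall>b. (\<lambda>x. D x b) \<in> bump_algebra r"
      using bump_algebra_deriv by blast
    then have "partial_deriv b u = (\<lambda>x. D x b)" for b
      using partial_deriv_eq by blast
    with D Suc.IH show ?case by (auto intro: differentiableI)
  qed
  then show ?thesis using assms unfolding smooth_def by blast
qed

text \<open>The mass is a nonnegative integral, so that the value 1 already entails
  integrability.\<close>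

definition mollifier :: "real \<Rightarrow> ('a::euclidean_space \<Rightarrow> real) \<Rightarrow> bool" where
  "mollifier r \<eta> \<longleftrightarrow> smooth \<eta> \<and> (\<forall>x. 0 \<le> \<eta> x) \<and> (\<forall>x. \<eta> x \<noteq> 0 \<longrightarrow> norm x < r) \<and>
     (\<integral>\<^sup>+x. ennreal (\<eta> x) \<partial>lborel) = 1"

text \<open>The profile of order 0 at r^2 - |x|^2 is positive exactly on the open ball, which has
  positive volume; its integral is therefore positive and can be normalised.\<close>

lemma mollifier_exists:
  assumes "r > 0"
  shows "\<exists>\<eta>::'a::euclidean_space \<Rightarrow> real. mollifier r \<eta>"
proof -
  define \<beta> where "\<beta> = (\<lambda>x::'a. bump_profile 0 (r\<^sup>2 - x \<bullet> x))"
  define I where "I = (LINT x|lborel. \<beta> x)"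
  have \<beta>: "\<beta> \<in> bump_algebra r" unfolding \<beta>_def by (rule bump_algebra.bump)
  have cont: "continuous_on S \<beta>" for S
    by (rule smooth_continuous_on[OF bump_algebra_smooth[OF \<beta>]])
  have pos: "\<beta> x \<ge> 0" for x by (simp add: \<beta>_def bump_profile_def)
  have supp: "\<beta> x \<noteq> 0 \<longleftrightarrow> norm x < r" for x
    using assms power2_less_imp_less[of "norm x" r]
    by (auto simp: \<beta>_def bump_profile_def power2_norm_eq_inner[symmetric] power_strict_mono)
  have int: "integrable lborel \<beta>"
  proof -
    have "integrable lborel (\<lambda>x. indicator (cball 0 r) x *\<^sub>R \<beta> x)"
      by (rule borel_integrable_compact) (auto intro: cont)
    also have "(\<lambda>x. indicator (cball 0 r) x *\<^sub>R \<beta> x) = \<beta>"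
    proof
      fix x
      show "indicator (cball 0 r) x *\<^sub>R \<beta> x = \<beta> x"
        using supp[of x] by (cases "\<beta> x = 0") (auto simp: indicator_def)
    qed
    finally show ?thesis .
  qed
  have "I \<noteq> 0"
  proof
    assume "I = 0"
    then have "AE x in lborel. \<beta> x = 0"
      using integral_nonneg_eq_0_iff_AE[OF int] pos by (simp add: I_def)
    then have "AE x in lborel. x \<notin> ball (0::'a) r" using supp by auto
    then have "emeasure lborel (ball (0::'a) r) = 0"
      by (subst (asm) AE_iff_null_sets[symmetric]) auto
    then have "measure lborel (ball (0::'a) r) = 0" by (simp add: measure_def)
    then show False using content_ball_pos[OF assms, of "0::'a"] by simp
  qed
  moreover have "I \<ge> 0" unfolding I_def by (intro integral_nonneg_AE) (simp add: pos)
  ultimately have I: "I > 0" by simp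
  let ?\<eta> = "\<lambda>x. (1 / I) * \<beta> x"
  have "smooth ?\<eta>"
    by (rule bump_algebra_smooth[where r=r]) (intro bump_algebra.mult bump_algebra.const \<beta>)
  moreover have "(\<integral>\<^sup>+x. ennreal (?\<eta> x) \<partial>lborel) = 1"
    using I int pos by (subst nn_integral_eq_integral) (auto simp: I_def)
  ultimately have "mollifier r ?\<eta>" using I pos supp by (auto simp: mollifier_def)
  then show ?thesis by blast
qed

section \<open>Integration along rays\<close>

lemma nn_integral_lborel_scale:
  fixes F :: "'a::euclidean_space \<Rightarrow> ennreal"
  assumes [measurable]: "F \<in> borel_measurable borel" and "c > 0"
  shows "(\<integral>\<^sup>+x. F (c *\<^sub>R x) \<partial>lborel) = ennreal (1 / c ^ DIM('a)) * (\<integral>\<^sup>+x. F x \<partial>lborel)"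
proof -
  have "(\<integral>\<^sup>+x. F x \<partial>lborel) = ennreal (c ^ DIM('a)) * (\<integral>\<^sup>+x. F (c *\<^sub>R x) \<partial>lborel)"
    using assms(2)
    by (subst lborel_affine[of c 0])
      (simp_all add: nn_integral_density nn_integral_distr nn_integral_cmult)
  then show ?thesis
    using assms(2) by (simp add: mult.assoc[symmetric] ennreal_mult[symmetric])
qed

text \<open>The integral in the ray parameter that remains after the substitution in
  \<open>nn_integral_ray_weight\<close>; the antiderivative vanishes at infinity.\<close>

lemma nn_integral_inverse_power_tail:
  assumes "m > 0" "n > 0"
  shows "(\<integral>\<^sup>+s. ennreal (if m < s then 1 / s ^ Suc n else 0) \<partial>lborel) = ennreal (1 / (n * m ^ n))"
proof -
  let ?F = "\<lambda>s::real. - (1 / (n * s ^ n))"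
  have "(\<integral>\<^sup>+s. ennreal (if m < s then 1 / s ^ Suc n else 0) \<partial>lborel) =
      (\<integral>\<^sup>+s. ennreal (1 / s ^ Suc n) * indicator {m..} s \<partial>lborel)"
    by (rule nn_integral_cong_AE) (use AE_lborel_singleton[of m] in eventually_elim, auto simp: indicator_def)
  also have "\<dots> = ennreal (0 - ?F m)"
  proof (rule nn_integral_FTC_atLeast)
    fix s assume "m \<le> s"
    with assms have "s > 0" by simp
    with assms show "DERIV ?F s :> 1 / s ^ Suc n"
      apply (auto intro!: derivative_eq_intros)
      apply (cases n; simp add: field_simps)
      done
  next
    show "(?F \<longlongrightarrow> 0) at_top"
      using assms by real_asymp
  qed (use assms in auto)
  finally show ?thesis by simp
qed

text \<open>
  The map \<open>(y, s) \<mapsto> s y\<close> pushes the density \<open>ray_weight a t\<close> forward to \<open>radial_weight a t\<close>; this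
  replaces integration in polar coordinates.
\<close>

definition ray_weight :: "real \<Rightarrow> real \<Rightarrow> 'a::euclidean_space \<times> real \<Rightarrow> real" where
  "ray_weight a t p = (if norm (fst p) < t \<and> a < snd p \<and> snd p * norm (fst p) < t then 1 / snd p else 0)"

definition radial_weight :: "real \<Rightarrow> real \<Rightarrow> 'a::euclidean_space \<Rightarrow> real" where
  "radial_weight a t z = (if norm z < t then 1 / (DIM('a) * max a (norm z / t) ^ DIM('a)) else 0)"

lemma ray_weight_measurable [measurable]: "ray_weight a t \<in> borel_measurable (borel \<Otimes>\<^sub>M borel)"
  unfolding ray_weight_def[abs_def] by measurable

lemma radial_weight_measurable [measurable]: "radial_weight a t \<in> borel_measurable borel"
  unfolding radial_weight_def[abs_def] by measurable

lemma ray_weight_nonneg: "a \<ge> 0 \<Longrightarrow> ray_weight a t p \<ge> 0"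
  by (simp add: ray_weight_def)

lemma radial_weight_nonneg: "a \<ge> 0 \<Longrightarrow> radial_weight a t z \<ge> 0"
  by (simp add: radial_weight_def)

text \<open>At fixed \<open>s\<close> the substitution z = s y turns dy into s^(-n) dz, and with the
  factor 1 / s of the weight the density becomes s^(-n-1). Integrating it over s > m, where m = max
  a (|z| / t), gives 1 / (n m^n).\<close>

lemma nn_integral_ray_weight:
  fixes F :: "'a::euclidean_space \<Rightarrow> ennreal"
  assumes F [measurable]: "F \<in> borel_measurable borel" and t: "t > 0" and a: "a \<ge> 0"
  shows "(\<integral>\<^sup>+p. ennreal (ray_weight a t p) * F (snd p *\<^sub>R fst p) \<partial>(lborel \<Otimes>\<^sub>M lborel)) =
    (\<integral>\<^sup>+z. ennreal (radial_weight a t z) * F z \<partial>lborel)"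
proof -
  define n where "n = DIM('a)"
  have n: "n > 0" by (simp add: n_def)
  \<comment> \<open>The ray weight after z = s y, with the Jacobian: |y| < t reads |z| / t < s, and
    s |y| < t reads |z| < t.\<close>
  define W where "W = (\<lambda>(z::'a) s::real. if norm z < t \<and> a < s \<and> norm z / t < s then 1 / s ^ Suc n else 0)"
  have W [measurable]: "case_prod W \<in> borel_measurable (borel \<Otimes>\<^sub>M borel)"
    unfolding W_def by measurable
  have "(\<integral>\<^sup>+p. ennreal (ray_weight a t p) * F (snd p *\<^sub>R fst p) \<partial>(lborel \<Otimes>\<^sub>M lborel)) =
      (\<integral>\<^sup>+s. \<integral>\<^sup>+y. ennreal (ray_weight a t (y, s)) * F (s *\<^sub>R y) \<partial>lborel \<partial>lborel)"
    by (subst lborel_pair.nn_integral_snd[symmetric]) auto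
  also have "\<dots> = (\<integral>\<^sup>+s. \<integral>\<^sup>+z. ennreal (W z s) * F z \<partial>lborel \<partial>lborel)"
  proof (rule nn_integral_cong)
    fix s :: real
    show "(\<integral>\<^sup>+y. ennreal (ray_weight a t (y, s)) * F (s *\<^sub>R y) \<partial>lborel) = (\<integral>\<^sup>+z. ennreal (W z s) * F z \<partial>lborel)"
    proof (cases "a < s")
      case False
      then show ?thesis by (simp add: ray_weight_def W_def)
    next
      case True
      with a have s: "s > 0" by simp
      have eq: "ray_weight a t (y, s) = s ^ n * W (s *\<^sub>R y) s" for y :: 'a
        using s t n True by (auto simp: ray_weight_def W_def field_simps)
      have "(\<integral>\<^sup>+y. ennreal (ray_weight a t (y, s)) * F (s *\<^sub>R y) \<partial>lborel) =
          (\<integral>\<^sup>+y. ennreal (s ^ n * W (s *\<^sub>R y) s) * F (s *\<^sub>R y) \<partial>lborel)"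
        by (simp only: eq)
      also have "\<dots> = ennreal (1 / s ^ n) * (\<integral>\<^sup>+z. ennreal (s ^ n * W z s) * F z \<partial>lborel)"
        unfolding n_def by (rule nn_integral_lborel_scale) (use s in auto)
      also have "\<dots> = (\<integral>\<^sup>+z. ennreal (1 / s ^ n) * (ennreal (s ^ n * W z s) * F z) \<partial>lborel)"
        by (rule nn_integral_cmult[symmetric]) simp
      also have "\<dots> = (\<integral>\<^sup>+z. ennreal (W z s) * F z \<partial>lborel)"
        using s by (simp add: mult.assoc[symmetric] ennreal_mult'[symmetric])
      finally show ?thesis .
    qed
  qed
  also have "\<dots> = (\<integral>\<^sup>+z. \<integral>\<^sup>+s. ennreal (W z s) * F z \<partial>lborel \<partial>lborel)"
    by (rule lborel_pair.Fubini') measurable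
  also have "\<dots> = (\<integral>\<^sup>+z. ennreal (radial_weight a t z) * F z \<partial>lborel)"
  proof (rule nn_integral_cong_AE, use AE_lborel_singleton[of 0] in eventually_elim)
    \<comment> \<open>For \<open>a = 0\<close> the integral in \<open>s\<close> diverges at z = 0,
      while \<open>radial_weight\<close> is 0 there by division by zero; the point is null.\<close>
    fix z :: 'a assume z: "z \<noteq> 0"
    define m where "m = max a (norm z / t)"
    have m: "m > 0" using z t by (simp add: m_def max.strict_coboundedI2)
    have "(\<integral>\<^sup>+s. ennreal (W z s) \<partial>lborel) = ennreal (radial_weight a t z)"
    proof (cases "norm z < t")
      case True
      then have "W z s = (if m < s then 1 / s ^ Suc n else 0)" for s
        by (simp add: W_def m_def)
      then show ?thesis
        using nn_integral_inverse_power_tail[OF m n] True by (simp add: radial_weight_def n_def m_def)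
    qed (simp add: W_def radial_weight_def)
    then show "(\<integral>\<^sup>+s. ennreal (W z s) * F z \<partial>lborel) = ennreal (radial_weight a t z) * F z"
      by (simp add: nn_integral_multc)
  qed
  finally show ?thesis .
qed

text \<open>Applied to indicators, the identity for nonnegative functions becomes one of measures,
  through which signed integrands can be transferred.\<close>

lemma distr_ray_weight:
  assumes t: "t > 0" and a: "a \<ge> 0"
  shows "distr (density (lborel \<Otimes>\<^sub>M lborel) (ray_weight a t)) borel (\<lambda>p. snd p *\<^sub>R fst p) =
    density (lborel :: 'a::euclidean_space measure) (radial_weight a t)"
proof (rule measure_eqI)
  fix A :: "'a set"
  assume "A \<in> sets (distr (density (lborel \<Otimes>\<^sub>M lborel) (ray_weight a t)) borel (\<lambda>p. snd p *\<^sub>R fst p))"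
  then have A [measurable]: "A \<in> sets borel" by simp
  have "emeasure (distr (density (lborel \<Otimes>\<^sub>M lborel) (ray_weight a t)) borel (\<lambda>p. snd p *\<^sub>R fst p)) A =
      (\<integral>\<^sup>+z. indicator A z \<partial>(distr (density (lborel \<Otimes>\<^sub>M lborel) (ray_weight a t)) borel (\<lambda>p. snd p *\<^sub>R fst p)))"
    by simp
  also have "\<dots> = (\<integral>\<^sup>+p. ennreal (ray_weight a t p) * indicator A (snd p *\<^sub>R fst p) \<partial>(lborel \<Otimes>\<^sub>M lborel))"
    by (subst nn_integral_distr) (auto simp: nn_integral_density)
  also have "\<dots> = (\<integral>\<^sup>+z. ennreal (radial_weight a t z) * indicator A z \<partial>lborel)"
    by (rule nn_integral_ray_weight) (use assms in auto)
  also have "\<dots> = emeasure (density lborel (radial_weight a t)) A"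
    by (simp add: emeasure_density)
  finally show "emeasure (distr (density (lborel \<Otimes>\<^sub>M lborel) (ray_weight a t)) borel (\<lambda>p. snd p *\<^sub>R fst p)) A =
    emeasure (density lborel (radial_weight a t)) A" .
qed simp

text \<open>Integrability is demanded only on the radial side; it passes to the product through the
  image measure and then licenses Fubini.\<close>

lemma integral_ray_weight:
  fixes F :: "'a::euclidean_space \<Rightarrow> real"
  assumes F [measurable]: "F \<in> borel_measurable borel" and t: "t > 0" and a: "a \<ge> 0"
    and int: "integrable lborel (\<lambda>z. radial_weight a t z * F z)"
  shows "(LINT y|lborel. LINT s|lborel. ray_weight a t (y, s) * F (s *\<^sub>R y)) =
      (LINT z|lborel. radial_weight a t z * F z)"
proof -
  let ?N = "density (lborel \<Otimes>\<^sub>M lborel) (ray_weight a t) :: ('a \<times> real) measure"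
  let ?p = "\<lambda>p::'a \<times> real. snd p *\<^sub>R fst p"
  have "integrable (density lborel (radial_weight a t)) F"
    using int radial_weight_nonneg[OF a] by (subst integrable_density) auto
  then have "integrable ?N (\<lambda>p. F (?p p))"
    unfolding distr_ray_weight[OF t a, symmetric] by (subst (asm) integrable_distr_eq) auto
  then have i: "integrable (lborel \<Otimes>\<^sub>M lborel) (\<lambda>p. ray_weight a t p * F (?p p))"
    by (subst (asm) integrable_density) (auto intro: AE_I2 ray_weight_nonneg[OF a])
  have "(LINT z|lborel. radial_weight a t z * F z) = (LINT z|(density lborel (radial_weight a t)). F z)"
    using radial_weight_nonneg[OF a] by (subst integral_density) auto
  also have "\<dots> = (LINT p|?N. F (?p p))"
    unfolding distr_ray_weight[OF t a, symmetric] by (subst integral_distr) auto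
  also have "\<dots> = (LINT p|(lborel \<Otimes>\<^sub>M lborel). ray_weight a t p * F (?p p))"
    by (subst integral_density) (auto intro: AE_I2 ray_weight_nonneg[OF a])
  also have "\<dots> = (LINT y|lborel. LINT s|lborel. ray_weight a t (y, s) * F (s *\<^sub>R y))"
    using lborel_pair.integral_fst'[OF i] by simp
  finally show ?thesis by simp
qed

section \<open>Means of smooth functions over spheres\<close>

declare borel_open[OF open_ball, measurable]

text \<open>The constant n / t turns the volume omega_n t^n of the ball into the area n omega_n
  t^(n-1) of the sphere.\<close>

definition sphere_weight :: "real \<Rightarrow> 'a::euclidean_space \<Rightarrow> real" where
  "sphere_weight t y = DIM('a) / t * indicator (ball 0 t) y"

lemma sphere_weight_measurable [measurable]: "sphere_weight t \<in> borel_measurable borel"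
  unfolding sphere_weight_def[abs_def] by measurable

lemma sphere_weight_nonneg: "t > 0 \<Longrightarrow> sphere_weight t y \<ge> 0"
  by (simp add: sphere_weight_def)

lemma ennreal_sphere_weight:
  "ennreal (sphere_weight t (y :: 'a::euclidean_space)) = ennreal (DIM('a) / t) * indicator (ball 0 t) y"
  by (simp add: sphere_weight_def indicator_def)

text \<open>The punctured closed ball in the definition differs from the open ball by a point and a
  sphere, both null. After translation to 0 the projection acts on the whole space, so that
  densities and change of variables apply without restricted spaces.\<close>

lemma sphere_measure_eq_distr:
  fixes x :: "'a::euclidean_space"
  assumes t: "t > 0"
  shows "sphere_measure x t = distr (density lborel (sphere_weight t)) borel
    (\<lambda>y. x + t *\<^sub>R sgn y)"
proof (rule measure_eqI)
  fix A :: "'a set" assume "A \<in> sets (sphere_measure x t)"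
  then have A [measurable]: "A \<in> sets borel" by (simp add: sphere_measure_def)
  let ?D = "cball x t - {x}" and ?p = "\<lambda>y. x + t *\<^sub>R sgn (y - x)"
  have p: "?p \<in> measurable (restrict_space lborel ?D) borel"
    by (intro measurable_restrict_space1) measurable
  have "emeasure (sphere_measure x t) A = ennreal (DIM('a) / t) * emeasure (restrict_space lborel ?D) (?p -` A \<inter> ?D)"
    unfolding sphere_measure_def
    by (subst emeasure_scale_measure, subst emeasure_distr[OF p]) (auto simp: space_restrict_space)
  also have "emeasure (restrict_space lborel ?D) (?p -` A \<inter> ?D) = emeasure lborel (?p -` A \<inter> ?D)"
    by (rule emeasure_restrict_space) auto
  also have "\<dots> = (\<integral>\<^sup>+y. indicator (?p -` A \<inter> ?D) y \<partial>lborel)"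
    by (rule nn_integral_indicator[symmetric]) (auto intro!: measurable_sets_borel[where M=borel])
  also have "\<dots> = (\<integral>\<^sup>+y. indicator (?p -` A \<inter> ?D) (x + y) \<partial>lborel)"
    by (subst lborel_distr_plus[of x, symmetric], subst nn_integral_distr)
      (auto intro!: borel_measurable_indicator measurable_sets_borel[where M=borel])
  also have "\<dots> = (\<integral>\<^sup>+y. indicator (ball 0 t) y * indicator A (x + t *\<^sub>R sgn y) \<partial>lborel)"
  proof (rule nn_integral_cong_AE)
    have "sphere (0::'a) t \<in> null_sets lborel"
      using negligible_sphere[of "0::'a" t] by (simp add: negligible_iff_null_sets null_sets_completion_iff)
    then have "AE y in lborel. y \<notin> sphere (0::'a) t" by (rule AE_not_in)
    then show "AE y in lborel. (indicator (?p -` A \<inter> ?D) (x + y) :: ennreal) =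
        indicator (ball 0 t) y * indicator A (x + t *\<^sub>R sgn y)"
      using AE_lborel_singleton[of 0]
    proof eventually_elim
      case (elim y)
      then have "x + y \<in> ?D \<longleftrightarrow> y \<in> ball 0 t" by (auto simp: dist_norm)
      then show ?case by (auto simp: indicator_def)
    qed
  qed
  also have "ennreal (DIM('a) / t) * \<dots> =
      (\<integral>\<^sup>+y. ennreal (sphere_weight t y) * indicator A (x + t *\<^sub>R sgn y) \<partial>lborel)"
    by (subst nn_integral_cmult[symmetric]) (auto simp: ennreal_sphere_weight mult.assoc)
  also have "\<dots> = (\<integral>\<^sup>+z. indicator A z \<partial>(distr (density lborel (sphere_weight t)) borel (\<lambda>y. x + t *\<^sub>R sgn y)))"
    by (subst nn_integral_distr) (auto simp: nn_integral_density)
  finally show "emeasure (sphere_measure x t) A =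
      emeasure (distr (density lborel (sphere_weight t)) borel (\<lambda>y. x + t *\<^sub>R sgn y)) A" by simp
qed (simp add: sphere_measure_def)

lemma sets_sphere_measure [measurable_cong, simp]: "sets (sphere_measure x t) = sets borel"
  by (simp add: sphere_measure_def)

lemma space_sphere_measure [simp]: "space (sphere_measure x t) = UNIV"
  by (simp add: sphere_measure_def space_scale_measure)

lemma nn_integral_sphere_measure:
  fixes h :: "'a::euclidean_space \<Rightarrow> ennreal"
  assumes [measurable]: "h \<in> borel_measurable borel" and t: "t > 0"
  shows "(\<integral>\<^sup>+y. h y \<partial>sphere_measure x t) =
    ennreal (DIM('a) / t) * (\<integral>\<^sup>+y\<in>ball 0 t. h (x + t *\<^sub>R sgn y) \<partial>lborel)"
  unfolding sphere_measure_eq_distr[OF t]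
  by (subst nn_integral_distr)
    (auto simp: nn_integral_density nn_integral_cmult[symmetric] ennreal_sphere_weight intro!: nn_integral_cong split: split_indicator)

lemma integral_sphere_measure:
  fixes h :: "'a::euclidean_space \<Rightarrow> real"
  assumes [measurable]: "h \<in> borel_measurable borel" and t: "t > 0"
  shows "(LINT y|sphere_measure x t. h y) =
    DIM('a) / t * (LINT y|lborel. indicator (ball 0 t) y * h (x + t *\<^sub>R sgn y))"
  unfolding sphere_measure_eq_distr[OF t]
  by (subst integral_distr, simp, simp, subst integral_density)
    (auto simp: sphere_weight_nonneg[OF t] intro!: AE_I2, simp add: sphere_weight_def mult.assoc)

lemma measure_sphere_measure:
  fixes x :: "'a::euclidean_space"
  assumes "t > 0"
  shows "measure (sphere_measure x t) UNIV = DIM('a) * measure lborel (ball (0::'a) 1) * t ^ (DIM('a) - 1)"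
  using assms by (simp add: measure_def[of "sphere_measure x t"] emeasure_sphere_measure_total)

lemma integrable_sphere_measure_continuous:
  fixes u :: "'a::euclidean_space \<Rightarrow> real"
  assumes t: "t > 0" and u: "continuous_on UNIV u"
  shows "integrable (sphere_measure x t) u"
proof -
  have [measurable]: "u \<in> borel_measurable borel" by (rule borel_measurable_continuous_onI[OF u])
  have "compact (u ` cball x t)"
    by (intro compact_continuous_image continuous_on_subset[OF u]) auto
  then obtain B where B: "\<And>y. y \<in> cball x t \<Longrightarrow> \<bar>u y\<bar> \<le> B"
    by (metis compact_imp_bounded bounded_iff image_eqI real_norm_def)
  have "(\<integral>\<^sup>+y. ennreal (norm (u y)) \<partial>sphere_measure x t) =
      ennreal (DIM('a) / t) * (\<integral>\<^sup>+y\<in>ball 0 t. ennreal \<bar>u (x + t *\<^sub>R sgn y)\<bar> \<partial>lborel)"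
    by (subst nn_integral_sphere_measure) (use t in auto)
  also have "\<dots> \<le> ennreal (DIM('a) / t) * (\<integral>\<^sup>+y\<in>ball (0::'a) t. ennreal B \<partial>lborel)"
    by (intro mult_left_mono nn_integral_mono)
      (use t in \<open>auto simp: indicator_def dist_norm norm_sgn intro!: ennreal_leI B\<close>)
  also have "\<dots> < \<infinity>"
    using t emeasure_bounded_finite[OF bounded_ball, of "0::'a" t]
    by (auto simp: nn_integral_cmult_indicator ennreal_mult_less_top)
  finally show ?thesis by (intro integrableI_bounded) auto
qed

text \<open>The ray from x through x + y leaves the ball of radius t at s = t / |y|, in the point x
  + t sgn y. The factor 1 / s of the weight cancels the s in \<open>s *\<^sub>R y\<close>, and what
  remains is the derivative of \<open>u\<close> along the ray, integrated from a to t / |y|.\<close>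

lemma ray_FTC:
  fixes u :: "'a::euclidean_space \<Rightarrow> real"
  assumes u: "smooth u" and a: "0 \<le> a" "a \<le> 1" and y: "y \<noteq> 0" "norm y < t"
  shows "has_bochner_integral lborel (\<lambda>s. ray_weight a t (y, s) * (gradient u (x + s *\<^sub>R y) \<bullet> (s *\<^sub>R y)))
    (u (x + t *\<^sub>R sgn y) - u (x + a *\<^sub>R y))"
proof -
  define b where "b = t / norm y"
  have b: "b > 1" using y by (simp add: b_def field_simps)
  note der = DERIV_along_line[OF u, of x y]
  have cont: "isCont (\<lambda>s. gradient u (x + s *\<^sub>R y) \<bullet> y) s" for s
    by (intro continuous_on_interior[where S=UNIV] continuous_intros
        continuous_on_compose2[OF continuous_on_gradient[OF u, of UNIV]]) auto
  have "has_bochner_integral lborel (\<lambda>s. gradient u (x + s *\<^sub>R y) \<bullet> y * indicator {a..b} s)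
      (u (x + b *\<^sub>R y) - u (x + a *\<^sub>R y))"
    by (rule has_bochner_integral_FTC_Icc_real) (use a b der cont in auto)
  also have "b *\<^sub>R y = t *\<^sub>R sgn y" by (simp add: b_def sgn_div_norm divide_inverse)
  finally have "has_bochner_integral lborel (\<lambda>s. gradient u (x + s *\<^sub>R y) \<bullet> y * indicator {a..b} s)
      (u (x + t *\<^sub>R sgn y) - u (x + a *\<^sub>R y))" .
  moreover have "AE s in lborel. gradient u (x + s *\<^sub>R y) \<bullet> y * indicator {a..b} s =
      ray_weight a t (y, s) * (gradient u (x + s *\<^sub>R y) \<bullet> (s *\<^sub>R y))"
    using AE_lborel_singleton[of a] AE_lborel_singleton[of b]
  proof eventually_elim
    case (elim s)
    have "s * norm y < t \<longleftrightarrow> s < b" using y by (simp add: b_def field_simps)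
    then show ?case using elim a y by (auto simp: ray_weight_def indicator_def)
  qed
  moreover have "(\<lambda>s. ray_weight a t (y, s) * (gradient u (x + s *\<^sub>R y) \<bullet> (s *\<^sub>R y))) \<in> borel_measurable lborel"
  proof -
    have [measurable]: "gradient u \<in> borel_measurable borel"
      by (rule borel_measurable_continuous_onI[OF continuous_on_gradient[OF u]])
    show ?thesis by measurable
  qed
  ultimately show ?thesis
    by (subst has_bochner_integral_cong_AE[symmetric]) (auto simp: has_bochner_integral_iff)
qed

lemma nn_integral_ball_translate:
  fixes h :: "'a::euclidean_space \<Rightarrow> ennreal"
  assumes [measurable]: "h \<in> borel_measurable borel"
  shows "(\<integral>\<^sup>+y\<in>ball 0 t. h (x + y) \<partial>lborel) = (\<integral>\<^sup>+y\<in>ball x t. h y \<partial>lborel)"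
  by (subst (2) lborel_distr_plus[of x, symmetric], subst nn_integral_distr)
    (auto intro!: nn_integral_cong simp: indicator_def dist_norm)

text \<open>For a = 1 the maximum in \<open>radial_weight\<close> is 1 on the ball, so the weight is
  the constant 1 / n; Cauchy-Schwarz adds a factor t. Multiplication by n / t leaves the coefficient
  1 in front of the gradient term.\<close>

lemma trace_inequality:
  fixes u :: "'a::euclidean_space \<Rightarrow> real"
  assumes u: "smooth u" and t: "t > 0"
  shows "(\<integral>\<^sup>+y. ennreal \<bar>u y\<bar> \<partial>sphere_measure x t) \<le>
    ennreal (DIM('a) / t) * (\<integral>\<^sup>+y\<in>ball x t. ennreal \<bar>u y\<bar> \<partial>lborel) +
    (\<integral>\<^sup>+y\<in>ball x t. ennreal (norm (gradient u y)) \<partial>lborel)"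
proof -
  have [measurable]: "u \<in> borel_measurable borel" "gradient u \<in> borel_measurable borel"
    by (rule borel_measurable_continuous_onI[OF smooth_continuous_on[OF u]],
        rule borel_measurable_continuous_onI[OF continuous_on_gradient[OF u]])
  \<comment> \<open>With 1 / s split off, the integrand on the ray depends on
    \<open>s *\<^sub>R y\<close> alone, as \<open>nn_integral_ray_weight\<close> requires.\<close>
  define H where "H = (\<lambda>z. gradient u (x + z) \<bullet> z)"
  have [measurable]: "H \<in> borel_measurable borel" unfolding H_def by measurable
  let ?n = "real DIM('a)"
  let ?R = "\<lambda>y. \<integral>\<^sup>+s. ennreal (ray_weight 1 t (y, s)) * ennreal \<bar>H (s *\<^sub>R y)\<bar> \<partial>lborel"
  have ptw: "ennreal \<bar>u (x + t *\<^sub>R sgn y)\<bar> * indicator (ball 0 t) y \<le>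
      ennreal \<bar>u (x + y)\<bar> * indicator (ball 0 t) y + ?R y" if y: "y \<noteq> 0" for y
  proof (cases "norm y < t")
    case True
    have bi: "has_bochner_integral lborel (\<lambda>s. ray_weight 1 t (y, s) * H (s *\<^sub>R y))
      (u (x + t *\<^sub>R sgn y) - u (x + y))"
      using ray_FTC[OF u, of 1 y t x] y True by (simp add: H_def)
    have "ennreal \<bar>u (x + t *\<^sub>R sgn y)\<bar> \<le> ennreal (\<bar>u (x + y)\<bar> + \<bar>u (x + t *\<^sub>R sgn y) - u (x + y)\<bar>)"
      by (intro ennreal_leI) simp
    also have "\<dots> = ennreal \<bar>u (x + y)\<bar> + ennreal \<bar>u (x + t *\<^sub>R sgn y) - u (x + y)\<bar>"
      by (simp add: ennreal_plus)
    also have "ennreal \<bar>u (x + t *\<^sub>R sgn y) - u (x + y)\<bar> \<le> ?R y"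
      using has_bochner_integral_norm_bound[OF bi]
      by (simp add: abs_mult ennreal_mult' ray_weight_nonneg)
    finally show ?thesis using True by (simp add: add_left_mono)
  qed simp
  have "(\<integral>\<^sup>+y\<in>ball 0 t. ennreal \<bar>u (x + t *\<^sub>R sgn y)\<bar> \<partial>lborel) \<le>
      (\<integral>\<^sup>+y. ennreal \<bar>u (x + y)\<bar> * indicator (ball 0 t) y + ?R y \<partial>lborel)"
    by (rule nn_integral_mono_AE) (use AE_lborel_singleton[of 0] in eventually_elim, rule ptw)
  also have "\<dots> = (\<integral>\<^sup>+y\<in>ball 0 t. ennreal \<bar>u (x + y)\<bar> \<partial>lborel) + (\<integral>\<^sup>+y. ?R y \<partial>lborel)"
    by (rule nn_integral_add) (auto intro!: lborel.borel_measurable_nn_integral)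
  also have "(\<integral>\<^sup>+y. ?R y \<partial>lborel) =
      (\<integral>\<^sup>+p. ennreal (ray_weight 1 t p) * ennreal \<bar>H (snd p *\<^sub>R fst p)\<bar> \<partial>(lborel \<Otimes>\<^sub>M lborel))"
    by (subst lborel.nn_integral_fst[symmetric]) auto
  also have "\<dots> = (\<integral>\<^sup>+z. ennreal (radial_weight 1 t z) * ennreal \<bar>H z\<bar> \<partial>lborel)"
    by (rule nn_integral_ray_weight) (use t in auto)
  also have "\<dots> \<le> (\<integral>\<^sup>+z\<in>ball 0 t. ennreal (t / ?n) * ennreal (norm (gradient u (x + z))) \<partial>lborel)"
  proof (rule nn_integral_mono)
    fix z :: 'a
    show "ennreal (radial_weight 1 t z) * ennreal \<bar>H z\<bar> \<le>
      ennreal (t / ?n) * ennreal (norm (gradient u (x + z))) * indicator (ball 0 t) z"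
    proof (cases "norm z < t")
      case True
      then have "radial_weight 1 t z = 1 / ?n"
        using t by (simp add: radial_weight_def max_absorb1)
      moreover have "\<bar>H z\<bar> \<le> t * norm (gradient u (x + z))"
        unfolding H_def using Cauchy_Schwarz_ineq2[of "gradient u (x + z)" z] True
        by (smt (verit, best) mult.commute mult_right_mono norm_ge_zero)
      ultimately have "radial_weight 1 t z * \<bar>H z\<bar> \<le> t / ?n * norm (gradient u (x + z))"
        by (simp add: divide_right_mono)
      then show ?thesis using True t
        by (simp add: ennreal_mult'[symmetric] radial_weight_nonneg ennreal_leI)
    qed (simp add: radial_weight_def)
  qed
  also have "\<dots> = ennreal (t / ?n) * (\<integral>\<^sup>+z\<in>ball 0 t. ennreal (norm (gradient u (x + z))) \<partial>lborel)"
    by (subst nn_integral_cmult[symmetric]) (auto simp: mult.assoc)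
  finally have le: "(\<integral>\<^sup>+y\<in>ball 0 t. ennreal \<bar>u (x + t *\<^sub>R sgn y)\<bar> \<partial>lborel) \<le>
    (\<integral>\<^sup>+y\<in>ball 0 t. ennreal \<bar>u (x + y)\<bar> \<partial>lborel) +
    ennreal (t / ?n) * (\<integral>\<^sup>+z\<in>ball 0 t. ennreal (norm (gradient u (x + z))) \<partial>lborel)"
    by (simp add: add_left_mono)
  have "(\<integral>\<^sup>+y. ennreal \<bar>u y\<bar> \<partial>sphere_measure x t) =
      ennreal (?n / t) * (\<integral>\<^sup>+y\<in>ball 0 t. ennreal \<bar>u (x + t *\<^sub>R sgn y)\<bar> \<partial>lborel)"
    by (rule nn_integral_sphere_measure) (use t in auto)
  also have "\<dots> \<le> ennreal (?n / t) * ((\<integral>\<^sup>+y\<in>ball 0 t. ennreal \<bar>u (x + y)\<bar> \<partial>lborel) +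
    ennreal (t / ?n) * (\<integral>\<^sup>+z\<in>ball 0 t. ennreal (norm (gradient u (x + z))) \<partial>lborel))"
    by (intro mult_left_mono le) simp
  also have "\<dots> = ennreal (?n / t) * (\<integral>\<^sup>+y\<in>ball 0 t. ennreal \<bar>u (x + y)\<bar> \<partial>lborel) +
    (\<integral>\<^sup>+z\<in>ball 0 t. ennreal (norm (gradient u (x + z))) \<partial>lborel)"
    using t by (simp add: distrib_left mult.assoc[symmetric] ennreal_mult'[symmetric])
  finally show ?thesis
    by (simp add: nn_integral_ball_translate[of "\<lambda>y. ennreal \<bar>u y\<bar>"]
        nn_integral_ball_translate[of "\<lambda>y. ennreal (norm (gradient u y))"])
qed

text \<open>A vector kernel of size |y|^(1-n), proportional to the gradient of the fundamental
  solution of the Laplacian.\<close>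

definition riesz :: "'a::euclidean_space \<Rightarrow> 'a" where
  "riesz y = (1 / norm y ^ DIM('a)) *\<^sub>R y"

lemma riesz_measurable [measurable]: "riesz \<in> borel_measurable borel"
  unfolding riesz_def[abs_def] by measurable

text \<open>For a = 0 the maximum in \<open>radial_weight\<close> is |z| / t, so the weight is t^n /
  (n |z|^n) on the ball. The surviving t^(n-1) cancels later against the area of the sphere.\<close>

lemma radial_weight_0:
  fixes z :: "'a::euclidean_space"
  assumes "t > 0"
  shows "DIM('a) / t * (radial_weight 0 t z * (v \<bullet> z)) =
    t ^ (DIM('a) - 1) * (indicator (ball 0 t) z * (riesz z \<bullet> v))"
proof -
  have "t ^ DIM('a) = t * t ^ (DIM('a) - 1)" by (simp add: power_eq_if)
  then show ?thesis
    using assms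
    by (auto simp: radial_weight_def riesz_def indicator_def field_simps inner_commute)
qed

text \<open>The ray substitution with a = 0, read backwards: the integrand becomes |y| on 0 < s < t
  / |y|, so each ray contributes at most t, and the ball has finite volume.\<close>

lemma nn_integral_riesz_finite:
  assumes "t > 0"
  shows "(\<integral>\<^sup>+z\<in>ball (0::'a::euclidean_space) t. ennreal (norm (riesz z)) \<partial>lborel) < \<infinity>"
proof -
  let ?n = "real DIM('a)"
  have "(\<integral>\<^sup>+z. ennreal (radial_weight 0 t z) * ennreal (norm z) \<partial>(lborel :: 'a measure)) =
      (\<integral>\<^sup>+p. ennreal (ray_weight 0 t p) * ennreal (norm (snd p *\<^sub>R fst p)) \<partial>((lborel :: 'a measure) \<Otimes>\<^sub>M lborel))"
    by (rule nn_integral_ray_weight[symmetric]) (use assms in auto)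
  also have "\<dots> = (\<integral>\<^sup>+y. \<integral>\<^sup>+s. ennreal (ray_weight 0 t (y, s)) * ennreal (norm (s *\<^sub>R y)) \<partial>lborel \<partial>(lborel :: 'a measure))"
    by (subst lborel.nn_integral_fst[symmetric]) auto
  also have "\<dots> \<le> (\<integral>\<^sup>+y. ennreal t * indicator (ball 0 t) y \<partial>(lborel :: 'a measure))"
  proof (rule nn_integral_mono_AE, use AE_lborel_singleton[of 0] in eventually_elim)
    fix y :: 'a assume y: "y \<noteq> 0"
    show "(\<integral>\<^sup>+s. ennreal (ray_weight 0 t (y, s)) * ennreal (norm (s *\<^sub>R y)) \<partial>lborel) \<le> ennreal t * indicator (ball 0 t) y"
    proof (cases "norm y < t")
      case True
      have "(\<integral>\<^sup>+s. ennreal (ray_weight 0 t (y, s)) * ennreal (norm (s *\<^sub>R y)) \<partial>lborel) \<le>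
          (\<integral>\<^sup>+s. ennreal (norm y) * indicator {0..t / norm y} s \<partial>lborel)"
        using y by (intro nn_integral_mono)
          (auto simp: ray_weight_def indicator_def ennreal_mult'[symmetric] field_simps)
      also have "\<dots> = ennreal t"
        using y assms by (simp add: nn_integral_cmult_indicator ennreal_mult'[symmetric])
      finally show ?thesis using True by simp
    qed (simp add: ray_weight_def)
  qed
  also have "\<dots> < \<infinity>"
    using emeasure_bounded_finite[OF bounded_ball, of "0::'a" t]
    by (auto simp: nn_integral_cmult_indicator ennreal_mult_less_top)
  finally have fin: "(\<integral>\<^sup>+z. ennreal (radial_weight 0 t z) * ennreal (norm z) \<partial>(lborel :: 'a measure)) < \<infinity>" .
  have "ennreal (norm (riesz z)) * indicator (ball 0 t) z =
      ennreal (?n / t ^ DIM('a)) * (ennreal (radial_weight 0 t z) * ennreal (norm z))" for z :: 'a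
    using assms by (auto simp: riesz_def radial_weight_def indicator_def ennreal_mult'[symmetric] power_divide
        intro!: arg_cong[where f=ennreal])
  then show ?thesis
    using fin by (simp add: nn_integral_cmult ennreal_mult_less_top)
qed

lemma integrable_riesz_continuous:
  fixes V :: "'a::euclidean_space \<Rightarrow> 'a"
  assumes t: "t > 0" and V: "continuous_on UNIV V"
  shows "integrable lborel (\<lambda>z. indicator (ball 0 t) z * (riesz z \<bullet> V z))"
proof -
  have [measurable]: "V \<in> borel_measurable borel" by (rule borel_measurable_continuous_onI[OF V])
  have "compact (V ` cball 0 t)"
    by (intro compact_continuous_image continuous_on_subset[OF V]) auto
  then obtain B where B: "\<And>y. y \<in> cball 0 t \<Longrightarrow> norm (V y) \<le> B"
    by (metis compact_imp_bounded bounded_iff image_eqI)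
  have "(\<integral>\<^sup>+z. ennreal (norm (indicator (ball 0 t) z * (riesz z \<bullet> V z))) \<partial>lborel) \<le>
      (\<integral>\<^sup>+z. ennreal B * (ennreal (norm (riesz z)) * indicator (ball 0 t) z) \<partial>(lborel :: 'a measure))"
  proof (intro nn_integral_mono)
    fix z :: 'a
    have "\<bar>riesz z \<bullet> V z\<bar> \<le> B * norm (riesz z)" if "norm z < t"
    proof -
      have "\<bar>riesz z \<bullet> V z\<bar> \<le> norm (riesz z) * norm (V z)" by (rule Cauchy_Schwarz_ineq2)
      also have "\<dots> \<le> norm (riesz z) * B" using B[of z] that by (intro mult_left_mono) auto
      finally show ?thesis by (simp add: mult.commute)
    qed
    then show "ennreal (norm (indicator (ball 0 t) z * (riesz z \<bullet> V z))) \<le>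
        ennreal B * (ennreal (norm (riesz z)) * indicator (ball 0 t) z)"
      by (auto simp: indicator_def ennreal_mult''[symmetric] intro!: ennreal_leI)
  qed
  also have "\<dots> < \<infinity>"
    using nn_integral_riesz_finite[OF t, where 'a='a] by (simp add: nn_integral_cmult ennreal_mult_less_top)
  finally show ?thesis by (intro integrableI_bounded) auto
qed

text \<open>The ray identity with a = 0 is integrated over the ball: u (x + t sgn y) gives t / n
  times the sphere integral, and u x is multiplied by the volume. After multiplication by n / t,
  both sides carry t^(n-1) and the area can be divided out. The gradient is taken at x + z, hence
  the sign opposite to that of the final formula.\<close>

lemma sphere_mean_smooth:
  fixes u :: "'a::euclidean_space \<Rightarrow> real"
  assumes u: "smooth u" and t: "t > 0"
  shows "(LINT y|sphere_measure x t. u y) / measure (sphere_measure x t) UNIV - u x =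
    1 / (DIM('a) * measure lborel (ball (0::'a) 1)) *
      (LINT z|lborel. indicator (ball 0 t) z * (riesz z \<bullet> gradient u (x + z)))"
proof -
  have [measurable]: "u \<in> borel_measurable borel" "gradient u \<in> borel_measurable borel"
    by (rule borel_measurable_continuous_onI[OF smooth_continuous_on[OF u]],
        rule borel_measurable_continuous_onI[OF continuous_on_gradient[OF u]])
  let ?n = "real DIM('a)"
  define H where "H = (\<lambda>z. gradient u (x + z) \<bullet> z)"
  have [measurable]: "H \<in> borel_measurable borel" unfolding H_def by measurable
  let ?K = "\<lambda>z. indicator (ball 0 t) z * (riesz z \<bullet> gradient u (x + z))"
  have intK: "integrable lborel ?K"
    by (intro integrable_riesz_continuous t continuous_on_compose2[OF continuous_on_gradient[OF u, of UNIV]]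
        continuous_intros) simp
  have eq: "?n / t * (radial_weight 0 t z * H z) = t ^ (DIM('a) - 1) * ?K z" for z
    using radial_weight_0[OF t] by (simp add: H_def)
  \<comment> \<open>Integrability is known for the kernel form; the identity \<open>eq\<close>
    carries it over, and the factor t / n then removes n / t.\<close>
  have "integrable lborel (\<lambda>z. ?n / t * (radial_weight 0 t z * H z))"
    unfolding eq using intK by simp
  then have "integrable lborel (\<lambda>z. t / ?n * (?n / t * (radial_weight 0 t z * H z)))"
    by (rule integrable_mult_right)
  then have intH: "integrable lborel (\<lambda>z. radial_weight 0 t z * H z)"
    using t by simp
  have intb: "integrable lborel (\<lambda>y. indicator (ball 0 t) y * u (x + t *\<^sub>R sgn y))"
  proof -
    have "integrable lborel (\<lambda>y. sphere_weight t y * u (x + t *\<^sub>R sgn y))"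
      using integrable_sphere_measure_continuous[OF t smooth_continuous_on[OF u], of x] t
      unfolding sphere_measure_eq_distr[OF t]
      by (simp add: integrable_distr_eq integrable_density sphere_weight_nonneg)
    then have "integrable lborel (\<lambda>y. t / ?n * (sphere_weight t y * u (x + t *\<^sub>R sgn y)))"
      by (rule integrable_mult_right)
    then show ?thesis using t by (simp add: sphere_weight_def)
  qed
  have intc: "integrable lborel (\<lambda>y::'a. indicator (ball 0 t) y * u x)"
    using emeasure_bounded_finite[OF bounded_ball, of "0::'a" t] by (intro integrable_mult_left) simp
  have "(LINT z|lborel. radial_weight 0 t z * H z) =
      (LINT y|lborel. LINT s|lborel. ray_weight 0 t (y, s) * H (s *\<^sub>R y))"
    by (rule integral_ray_weight[symmetric]) (use intH t in auto)
  also have "\<dots> = (LINT y|lborel. indicator (ball 0 t) y * u (x + t *\<^sub>R sgn y) - indicator (ball 0 t) y * u x)"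
  proof (rule integral_cong_AE)
    show "AE y in lborel. (LINT s|lborel. ray_weight 0 t (y, s) * H (s *\<^sub>R y)) =
        indicator (ball 0 t) y * u (x + t *\<^sub>R sgn y) - indicator (ball 0 t) y * u x"
      using AE_lborel_singleton[of 0]
    proof eventually_elim
      case (elim y)
      show ?case
      proof (cases "norm y < t")
        case True
        then show ?thesis
          using has_bochner_integral_integral_eq[OF ray_FTC[OF u, of 0 y t x]] elim by (simp add: H_def)
      qed (simp add: ray_weight_def)
    qed
  qed measurable
  also have "\<dots> = (LINT y|lborel. indicator (ball 0 t) y * u (x + t *\<^sub>R sgn y)) - measure lborel (ball (0::'a) t) * u x"
    using intb intc by simp
  finally have diff: "(LINT y|lborel. indicator (ball 0 t) y * u (x + t *\<^sub>R sgn y)) -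
      measure lborel (ball (0::'a) t) * u x = (LINT z|lborel. radial_weight 0 t z * H z)" by simp
  have "(LINT y|sphere_measure x t. u y) - ?n / t * measure lborel (ball (0::'a) t) * u x =
      ?n / t * (LINT z|lborel. radial_weight 0 t z * H z)"
    unfolding diff[symmetric] using t by (simp add: integral_sphere_measure right_diff_distrib mult.assoc)
  also have "\<dots> = (LINT z|lborel. ?n / t * (radial_weight 0 t z * H z))"
    by (rule integral_mult_right_zero[symmetric])
  also have "\<dots> = t ^ (DIM('a) - 1) * (LINT z|lborel. ?K z)"
    by (simp only: eq integral_mult_right_zero)
  also have "measure lborel (ball (0::'a) t) = t ^ DIM('a) * measure lborel (ball (0::'a) 1)"
    using t by (simp add: content_ball)
  finally show ?thesis
    using t content_ball_pos[of 1 "0::'a"]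
    by (simp add: measure_sphere_measure field_simps power_eq_if[of t "DIM('a)"])
qed

section \<open>Mollification\<close>

lemma nn_integral_lborel_reflect:
  fixes h :: "'a::euclidean_space \<Rightarrow> ennreal"
  assumes [measurable]: "h \<in> borel_measurable borel"
  shows "(\<integral>\<^sup>+y. h (x - y) \<partial>lborel) = (\<integral>\<^sup>+y. h y \<partial>lborel)"
  by (subst (2) lborel_affine[of "-1" x]) (simp_all add: nn_integral_density nn_integral_distr)

text \<open>The exceptional set lies in a Borel null set, and reflection preserves the measure of
  Borel sets.\<close>

lemma AE_lebesgue_reflect:
  fixes P :: "'a::euclidean_space \<Rightarrow> bool"
  assumes "AE y in lebesgue. P y"
  shows "AE y in lebesgue. P (x - y)"
proof -
  from assms have "AE y in lborel. P y" by (simp add: AE_completion_iff)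
  then obtain N where N: "N \<in> null_sets lborel" "\<And>y. y \<notin> N \<Longrightarrow> P y"
    by (rule AE_E3) auto
  then have [measurable]: "N \<in> sets borel" by auto
  have "(\<integral>\<^sup>+y. indicator N (x - y) \<partial>lborel) = (\<integral>\<^sup>+y. indicator N y \<partial>lborel)"
    by (rule nn_integral_lborel_reflect) simp
  also have "\<dots> = 0" using N by auto
  finally have "AE y in lborel. (indicator N (x - y) :: ennreal) = 0"
    by (subst (asm) nn_integral_0_iff_AE) auto
  then have "AE y in lborel. P (x - y)"
    by eventually_elim (use N in \<open>auto simp: indicator_def split: if_splits\<close>)
  then show ?thesis by (simp add: AE_completion_iff)
qed

lemma lebesgue_measurable_borel_version:
  fixes F :: "'a::euclidean_space \<Rightarrow> ennreal"
  assumes "F \<in> borel_measurable lebesgue"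
  obtains F' where "F' \<in> borel_measurable borel" "AE x in lebesgue. F x = F' x"
  using completion_ex_borel_measurable[OF assms] by (auto simp: AE_completion_iff)

text \<open>\<open>F\<close> is only Lebesgue measurable, whereas Tonelli is applied to Borel
  functions on the product. A Borel version equal almost everywhere leaves every inner integral
  unchanged.\<close>

lemma nn_integral_convolution:
  fixes F \<kappa> :: "'a::euclidean_space \<Rightarrow> ennreal"
  assumes F: "F \<in> borel_measurable lebesgue" and \<kappa> [measurable]: "\<kappa> \<in> borel_measurable borel"
  shows "(\<lambda>x. \<integral>\<^sup>+y. \<kappa> (x - y) * F y \<partial>lebesgue) \<in> borel_measurable borel" (is ?meas)
    and "(\<integral>\<^sup>+x. \<integral>\<^sup>+y. \<kappa> (x - y) * F y \<partial>lebesgue \<partial>lebesgue) = (\<integral>\<^sup>+x. \<kappa> x \<partial>lborel) * (\<integral>\<^sup>+y. F y \<partial>lebesgue)" (is ?eq)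
    and "(\<integral>\<^sup>+y. \<kappa> (x - y) * F y \<partial>lebesgue) = (\<integral>\<^sup>+y. \<kappa> y * F (x - y) \<partial>lebesgue)" (is ?refl)
proof -
  obtain F' where F' [measurable]: "F' \<in> borel_measurable borel" and ae: "AE x in lebesgue. F x = F' x"
    using lebesgue_measurable_borel_version[OF F] .
  have inner: "(\<integral>\<^sup>+y. \<kappa> (x - y) * F y \<partial>lebesgue) = (\<integral>\<^sup>+y. \<kappa> (x - y) * F' y \<partial>lborel)" for x
  proof -
    have "(\<integral>\<^sup>+y. \<kappa> (x - y) * F y \<partial>lebesgue) = (\<integral>\<^sup>+y. \<kappa> (x - y) * F' y \<partial>lebesgue)"
      by (rule nn_integral_cong_AE) (use ae in eventually_elim, simp)
    then show ?thesis by (simp add: nn_integral_completion)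
  qed
  show ?meas unfolding inner by measurable
  have "(\<integral>\<^sup>+x. \<integral>\<^sup>+y. \<kappa> (x - y) * F' y \<partial>lborel \<partial>lborel) = (\<integral>\<^sup>+y. \<integral>\<^sup>+x. \<kappa> (x - y) * F' y \<partial>lborel \<partial>lborel)"
    by (rule lborel_pair.Fubini'[symmetric]) measurable
  also have "\<dots> = (\<integral>\<^sup>+y. (\<integral>\<^sup>+x. \<kappa> x \<partial>lborel) * F' y \<partial>lborel)"
  proof (rule nn_integral_cong)
    fix y :: 'a
    have "(\<integral>\<^sup>+x. \<kappa> (x - y) \<partial>lborel) = (\<integral>\<^sup>+x. \<kappa> x \<partial>lborel)"
      by (subst (2) lborel_distr_plus[of "-y", symmetric], subst nn_integral_distr) auto
    then show "(\<integral>\<^sup>+x. \<kappa> (x - y) * F' y \<partial>lborel) = (\<integral>\<^sup>+x. \<kappa> x \<partial>lborel) * F' y"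
      by (simp add: nn_integral_multc)
  qed
  also have "\<dots> = (\<integral>\<^sup>+x. \<kappa> x \<partial>lborel) * (\<integral>\<^sup>+y. F' y \<partial>lborel)"
    by (rule nn_integral_cmult) simp
  also have "(\<integral>\<^sup>+y. F' y \<partial>lborel) = (\<integral>\<^sup>+y. F y \<partial>lebesgue)"
    using nn_integral_cong_AE[OF ae] by (simp add: nn_integral_completion)
  finally show ?eq unfolding inner by (simp add: nn_integral_completion)
  have "(\<integral>\<^sup>+y. \<kappa> (x - y) * F' y \<partial>lborel) = (\<integral>\<^sup>+y. \<kappa> y * F' (x - y) \<partial>lborel)"
    by (subst nn_integral_lborel_reflect[symmetric, where x=x]) auto
  also have "\<dots> = (\<integral>\<^sup>+y. \<kappa> y * F' (x - y) \<partial>lebesgue)"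
    by (simp add: nn_integral_completion)
  also have "\<dots> = (\<integral>\<^sup>+y. \<kappa> y * F (x - y) \<partial>lebesgue)"
    by (rule nn_integral_cong_AE) (use AE_lebesgue_reflect[OF ae, of x] in eventually_elim, simp)
  finally show ?refl unfolding inner .
qed

section \<open>Local integrability\<close>

lemma locally_integrable_measurable:
  assumes "locally_integrable f"
  shows "f \<in> borel_measurable lebesgue"
proof -
  have "(\<lambda>x. indicator (cball 0 (real n)) x *\<^sub>R f x) \<in> borel_measurable lebesgue" for n
    using assms unfolding locally_integrable_def set_integrable_def
    by (intro borel_measurable_integrable) auto
  moreover have "(\<lambda>n. indicator (cball 0 (real n)) x *\<^sub>R f x) \<longlonglongrightarrow> f x" for x
  proof (rule tendsto_eventually)
    obtain N :: nat where "norm x \<le> N" using real_arch_simple by blast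
    then show "\<forall>\<^sub>F n in sequentially. indicator (cball 0 (real n)) x *\<^sub>R f x = f x"
      by (auto simp: eventually_sequentially indicator_def intro!: exI[of _ N])
  qed
  ultimately show ?thesis by (rule borel_measurable_LIMSEQ_metric)
qed

lemma locally_integrable_nn_integral:
  assumes "locally_integrable f" "bounded S"
  shows "(\<integral>\<^sup>+x\<in>S. ennreal (norm (f x)) \<partial>lebesgue) < \<infinity>"
proof -
  obtain r where "\<forall>y\<in>S. dist 0 y \<le> r" using assms(2) bounded_any_center by metis
  then have r: "S \<subseteq> cball 0 r" by auto
  have "integrable lebesgue (\<lambda>x. indicator (cball 0 r) x *\<^sub>R f x)"
    using assms(1)[unfolded locally_integrable_def set_integrable_def, rule_format, OF compact_cball] .
  then have fin: "(\<integral>\<^sup>+x. ennreal (norm (indicator (cball 0 r) x *\<^sub>R f x)) \<partial>lebesgue) < \<infinity>"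
    by (simp add: integrable_iff_bounded)
  have le: "(\<integral>\<^sup>+x\<in>S. ennreal (norm (f x)) \<partial>lebesgue) \<le> (\<integral>\<^sup>+x. ennreal (norm (indicator (cball 0 r) x *\<^sub>R f x)) \<partial>lebesgue)"
  proof (rule nn_integral_mono)
    fix x
    show "ennreal (norm (f x)) * indicator S x \<le> ennreal (norm (indicator (cball 0 r) x *\<^sub>R f x))"
    proof (cases "x \<in> S")
      case True
      then have "x \<in> cball 0 r" using r by blast
      then show ?thesis using True by simp
    qed simp
  qed
  show ?thesis using le fin by (rule le_less_trans)
qed

lemma locally_integrable_inner:
  fixes f :: "'a::euclidean_space \<Rightarrow> 'b::euclidean_space"
  assumes "locally_integrable f"
  shows "locally_integrable (\<lambda>x. f x \<bullet> b)"
  unfolding locally_integrable_def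
proof (intro allI impI)
  fix K :: "'a set" assume "compact K"
  with assms have "integrable lebesgue (\<lambda>x. indicator K x *\<^sub>R f x)"
    unfolding locally_integrable_def set_integrable_def by auto
  then have "integrable lebesgue (\<lambda>x. (indicator K x *\<^sub>R f x) \<bullet> b)" by (rule integrable_inner_left)
  then show "(\<lambda>x. f x \<bullet> b) absolutely_integrable_on K" by (simp add: set_integrable_def)
qed

lemma continuous_lebesgue_measurable:
  fixes \<phi> :: "'a::euclidean_space \<Rightarrow> 'b::metric_space"
  assumes "continuous_on UNIV \<phi>"
  shows "\<phi> \<in> borel_measurable lebesgue"
  by (rule measurable_completion) (use borel_measurable_continuous_onI[OF assms] in simp)

lemma locally_integrable_mult_continuous:
  fixes f \<phi> :: "'a::euclidean_space \<Rightarrow> real"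
  assumes f: "locally_integrable f" and \<phi>: "continuous_on UNIV \<phi>" and K: "compact K"
    and supp: "\<And>y. y \<notin> K \<Longrightarrow> \<phi> y = 0"
  shows "integrable lebesgue (\<lambda>y. f y * \<phi> y)"
proof -
  have "compact (\<phi> ` K)" by (intro compact_continuous_image continuous_on_subset[OF \<phi>] K) auto
  then obtain B where B: "\<And>y. y \<in> K \<Longrightarrow> \<bar>\<phi> y\<bar> \<le> B"
    by (metis compact_imp_bounded bounded_iff image_eqI real_norm_def)
  have "integrable lebesgue (\<lambda>x. indicator K x *\<^sub>R f x)"
    using f K unfolding locally_integrable_def set_integrable_def by auto
  then have "integrable lebesgue (\<lambda>x. B * (indicator K x *\<^sub>R f x))" by (rule integrable_mult_right)
  then show ?thesis
  proof (rule Bochner_Integration.integrable_bound)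
    show "(\<lambda>y. f y * \<phi> y) \<in> borel_measurable lebesgue"
      using locally_integrable_measurable[OF f] continuous_lebesgue_measurable[OF \<phi>] by measurable
    show "AE y in lebesgue. norm (f y * \<phi> y) \<le> norm (B * (indicator K y *\<^sub>R f y))"
    proof (rule AE_I2)
      fix y
      show "norm (f y * \<phi> y) \<le> norm (B * (indicator K y *\<^sub>R f y))"
      proof (cases "y \<in> K")
        case True
        then have "\<bar>\<phi> y\<bar> \<le> \<bar>B\<bar>" using B[of y] by simp
        then show ?thesis using True by (simp add: abs_mult mult.commute mult_right_mono)
      qed (simp add: supp)
    qed
  qed
qed

section \<open>Mollified functions: smoothness, and gradients as mollified weak gradients\<close>

definition mollify :: "('a::euclidean_space \<Rightarrow> real) \<Rightarrow> ('a \<Rightarrow> real) \<Rightarrow> 'a \<Rightarrow> real" where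
  "mollify \<eta> f x = (LINT y|lebesgue. f y * \<eta> (x - y))"

lemma mollify_integrable:
  fixes f \<eta> :: "'a::euclidean_space \<Rightarrow> real"
  assumes f: "locally_integrable f" and \<eta>: "continuous_on UNIV \<eta>" and supp: "\<forall>z. norm z > r \<longrightarrow> \<eta> z = 0"
  shows "integrable lebesgue (\<lambda>y. f y * \<eta> (x - y))"
proof (rule locally_integrable_mult_continuous[OF f, where K="cball x r"])
  show "continuous_on UNIV (\<lambda>y. \<eta> (x - y))"
    by (rule continuous_on_compose2[OF \<eta>]) (auto intro!: continuous_intros)
qed (auto simp: supp dist_norm)

lemma partial_deriv_support:
  fixes \<eta> :: "'a::euclidean_space \<Rightarrow> real"
  assumes supp: "\<forall>z. norm z > r \<longrightarrow> \<eta> z = 0"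
  shows "\<forall>z. norm z > r \<longrightarrow> partial_deriv b \<eta> z = 0"
proof (intro allI impI)
  fix z :: 'a assume z: "norm z > r"
  have "((\<lambda>z. 0) has_derivative (\<lambda>h. 0)) (at z)" by simp
  then have "(\<eta> has_derivative (\<lambda>h. 0)) (at z)"
  proof (rule has_derivative_transform_within_open[where s="- cball 0 r"])
    show "open (- cball (0::'a) r)" by (simp add: open_Compl)
  qed (use z supp in auto)
  from partial_deriv_eq[OF this] show "partial_deriv b \<eta> z = 0" .
qed

text \<open>The error is uniform in \<open>z\<close>, so that it can be integrated against
  \<open>f\<close>. Near the support it is controlled by the mean value theorem and uniform
  continuity of the gradient; farther out all terms vanish.\<close>

lemma uniform_linearization:
  fixes \<eta> :: "'a::euclidean_space \<Rightarrow> real"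
  assumes \<eta>: "smooth \<eta>" and supp: "\<forall>z. norm z > r \<longrightarrow> \<eta> z = 0" and e: "e > 0"
  shows "\<exists>d>0. d \<le> 1 \<and> (\<forall>z h. norm h < d \<longrightarrow> \<bar>\<eta> (z + h) - \<eta> z - gradient \<eta> z \<bullet> h\<bar> \<le> e * norm h)"
proof -
  have grad0: "gradient \<eta> z = 0" if "norm z > r" for z
    using partial_deriv_support[OF supp] that by (simp add: gradient_def)
  \<comment> \<open>Points with |z| <= r + 1 are moved by less than 1.\<close>
  have "uniformly_continuous_on (cball 0 (r + 2)) (gradient \<eta>)"
    by (intro compact_uniformly_continuous continuous_on_gradient[OF \<eta>]) auto
  then obtain d where "d > 0" and d: "\<forall>z\<in>cball 0 (r + 2). \<forall>w\<in>cball 0 (r + 2). dist w z < d \<longrightarrow>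
      dist (gradient \<eta> w) (gradient \<eta> z) < e"
    using e unfolding uniformly_continuous_on_def by blast
  have "\<bar>\<eta> (z + h) - \<eta> z - gradient \<eta> z \<bullet> h\<bar> \<le> e * norm h" if h: "norm h < min d 1" for z h
  proof (cases "norm z \<le> r + 1")
    case True
    have "\<exists>s::real. 0 < s \<and> s < 1 \<and>
        \<eta> (z + 1 *\<^sub>R h) - \<eta> (z + 0 *\<^sub>R h) = (1 - 0) * (gradient \<eta> (z + s *\<^sub>R h) \<bullet> h)"
      by (rule MVT2[where a=0 and b=1 and f="\<lambda>s. \<eta> (z + s *\<^sub>R h)" and f'="\<lambda>s. gradient \<eta> (z + s *\<^sub>R h) \<bullet> h"])
        (simp, rule DERIV_along_line[OF \<eta>])
    then obtain s where s: "0 < s" "s < 1" "\<eta> (z + 1 *\<^sub>R h) - \<eta> (z + 0 *\<^sub>R h) = (1 - 0) * (gradient \<eta> (z + s *\<^sub>R h) \<bullet> h)"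
      by blast
    have sh: "norm (s *\<^sub>R h) \<le> norm h" using s by (simp add: mult_left_le_one_le)
    have "norm (z + s *\<^sub>R h) \<le> r + 2" using norm_triangle_ineq[of z "s *\<^sub>R h"] sh h True by simp
    then have "z + s *\<^sub>R h \<in> cball 0 (r + 2)" "z \<in> cball 0 (r + 2)" using True by simp_all
    moreover have "dist (z + s *\<^sub>R h) z < d" using sh h by (simp add: dist_norm)
    ultimately have "norm (gradient \<eta> (z + s *\<^sub>R h) - gradient \<eta> z) < e"
      using d unfolding dist_norm by blast
    then have "\<bar>(gradient \<eta> (z + s *\<^sub>R h) - gradient \<eta> z) \<bullet> h\<bar> \<le> e * norm h"
      by (intro order_trans[OF Cauchy_Schwarz_ineq2] mult_right_mono) auto
    then show ?thesis using s(3) by (simp add: inner_diff_left)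
  next
    case False
    have "norm (z + h) > r" using norm_triangle_ineq2[of z "-h"] False h by simp
    moreover have "norm z > r" using False by simp
    ultimately have "\<eta> (z + h) = 0" "\<eta> z = 0" "gradient \<eta> z = 0" using supp grad0 by auto
    then show ?thesis using e by simp
  qed
  then show ?thesis using \<open>d > 0\<close> by (intro exI[of _ "min d 1"]) auto
qed

text \<open>Differentiation under the integral sign: the Taylor remainder of \<open>\<eta>\<close>
  is uniformly small relative to |h| and, as |h| < 1, vanishes for y outside
  \<open>cball x (r + 1)\<close>; the L^1 norm of \<open>f\<close> on that ball bounds the total
  error.\<close>

lemma mollify_has_derivative:
  fixes f \<eta> :: "'a::euclidean_space \<Rightarrow> real"
  assumes f: "locally_integrable f" and \<eta>: "smooth \<eta>" and supp: "\<forall>z. norm z > r \<longrightarrow> \<eta> z = 0"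
  shows "(mollify \<eta> f has_derivative (\<lambda>h. (\<Sum>b\<in>Basis. mollify (partial_deriv b \<eta>) f x *\<^sub>R b) \<bullet> h)) (at x)"
proof -
  let ?V = "\<Sum>b\<in>Basis. mollify (partial_deriv b \<eta>) f x *\<^sub>R b"
  note int = mollify_integrable[OF f smooth_continuous_on[OF \<eta>] supp]
  have intb: "integrable lebesgue (\<lambda>y. f y * partial_deriv b \<eta> (x - y))" if "b \<in> Basis" for b
    by (rule mollify_integrable[OF f smooth_continuous_on[OF smooth_partial_deriv[OF \<eta> that]] partial_deriv_support[OF supp]])
  define C where "C = (LINT y|lebesgue. \<bar>indicator (cball x (r + 1)) y * f y\<bar>)"
  have intC: "integrable lebesgue (\<lambda>y. \<bar>indicator (cball x (r + 1)) y * f y\<bar>)"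
    using f unfolding locally_integrable_def set_integrable_def by (intro integrable_abs) auto
  have C: "C \<ge> 0" unfolding C_def by (rule integral_nonneg_AE) simp
  have V: "?V \<bullet> h = (LINT y|lebesgue. f y * (gradient \<eta> (x - y) \<bullet> h))"
    and intV: "integrable lebesgue (\<lambda>y. f y * (gradient \<eta> (x - y) \<bullet> h))" for h
  proof -
    have eq: "f y * (gradient \<eta> (x - y) \<bullet> h) = (\<Sum>b\<in>Basis. f y * partial_deriv b \<eta> (x - y) * (b \<bullet> h))" for y
      by (simp add: gradient_def inner_sum_left sum_distrib_left mult.assoc)
    show "integrable lebesgue (\<lambda>y. f y * (gradient \<eta> (x - y) \<bullet> h))"
      unfolding eq by (intro Bochner_Integration.integrable_sum integrable_mult_left intb)
    show "?V \<bullet> h = (LINT y|lebesgue. f y * (gradient \<eta> (x - y) \<bullet> h))"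
      unfolding eq by (subst Bochner_Integration.integral_sum) (auto simp: inner_sum_left mollify_def intb)
  qed
  show ?thesis
    unfolding has_derivative_at_alt
  proof (intro conjI allI impI)
    show "bounded_linear (\<lambda>h. ?V \<bullet> h)" by (rule bounded_linear_inner_right)
    fix e :: real assume e: "e > 0"
    \<comment> \<open>The \<open>+ 1\<close> guards against \<open>C = 0\<close>.\<close>
    define e' where "e' = e / (C + 1)"
    have e': "e' > 0" "e' * C \<le> e" using e C by (auto simp: e'_def field_simps)
    obtain d where d: "d > 0" "d \<le> 1" "\<And>z h. norm h < d \<Longrightarrow> \<bar>\<eta> (z + h) - \<eta> z - gradient \<eta> z \<bullet> h\<bar> \<le> e' * norm h"
      using uniform_linearization[OF \<eta> supp e'(1)] by blast
    have "norm (mollify \<eta> f w - mollify \<eta> f x - ?V \<bullet> (w - x)) \<le> e * norm (w - x)" if w: "norm (w - x) < d" for w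
    proof -
      define h where "h = w - x"
      have wh: "w = x + h" by (simp add: h_def)
      let ?g = "\<lambda>y. f y * (\<eta> (x - y + h) - \<eta> (x - y) - gradient \<eta> (x - y) \<bullet> h)"
      have geq: "?g y = f y * \<eta> (w - y) - f y * \<eta> (x - y) - f y * (gradient \<eta> (x - y) \<bullet> h)" for y
        by (simp add: wh algebra_simps)
      have "mollify \<eta> f w - mollify \<eta> f x - ?V \<bullet> h = (LINT y|lebesgue. ?g y)"
        unfolding V unfolding mollify_def geq by (simp add: int intV)
      also have "norm \<dots> \<le> (LINT y|lebesgue. e' * norm h * \<bar>indicator (cball x (r + 1)) y * f y\<bar>)"
      proof (rule Bochner_Integration.integral_norm_bound_integral)
        show "integrable lebesgue ?g" unfolding geq by (intro Bochner_Integration.integrable_diff int intV)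
        show "integrable lebesgue (\<lambda>y. e' * norm h * \<bar>indicator (cball x (r + 1)) y * f y\<bar>)"
          by (intro integrable_mult_right intC)
        fix y
        show "norm (?g y) \<le> e' * norm h * \<bar>indicator (cball x (r + 1)) y * f y\<bar>"
        proof (cases "y \<in> cball x (r + 1)")
          case True
          then show ?thesis
            using mult_left_mono[OF d(3)[of h "x - y"], of "\<bar>f y\<bar>"] w
            by (simp add: abs_mult h_def[symmetric] mult_ac)
        next
          case False
          then have n: "norm (x - y) > r + 1" by (simp add: dist_norm)
          moreover have "norm (x - y + h) > r"
            using norm_triangle_ineq2[of "x - y" "-h"] n w d(2) by (simp add: h_def norm_minus_commute)
          ultimately have "\<eta> (x - y + h) = 0" "\<eta> (x - y) = 0" "gradient \<eta> (x - y) = 0"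
            using supp partial_deriv_support[OF supp] n by (auto simp: gradient_def)
          then show ?thesis using False by simp
        qed
      qed
      also have "\<dots> = e' * C * norm h" by (simp add: C_def)
      also have "\<dots> \<le> e * norm h" using e' by (simp add: mult_right_mono)
      finally show ?thesis by (simp add: h_def)
    qed
    then show "\<exists>d>0. \<forall>w. norm (w - x) < d \<longrightarrow> norm (mollify \<eta> f w - mollify \<eta> f x - ?V \<bullet> (w - x)) \<le> e * norm (w - x)"
      using d(1) by blast
  qed
qed

lemma partial_deriv_mollify:
  assumes "locally_integrable f" "smooth \<eta>" "\<forall>z. norm z > r \<longrightarrow> \<eta> z = 0" "b \<in> Basis"
  shows "partial_deriv b (mollify \<eta> f) = mollify (partial_deriv b \<eta>) f"
proof
  fix x
  show "partial_deriv b (mollify \<eta> f) x = mollify (partial_deriv b \<eta>) f x"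
    using assms(4) by (subst partial_deriv_eq[OF mollify_has_derivative[OF assms(1-3)]]) simp
qed

text \<open>A partial derivative is again a mollification, with the kernel
  \<open>partial_deriv b \<eta>\<close> and the same \<open>r\<close>; hence the induction
  generalises over \<open>\<eta>\<close>.\<close>

lemma smooth_mollify:
  fixes f \<eta> :: "'a::euclidean_space \<Rightarrow> real"
  assumes "locally_integrable f" "smooth \<eta>" "\<forall>z. norm z > r \<longrightarrow> \<eta> z = 0"
  shows "smooth (mollify \<eta> f)"
proof -
  have "continuously_differentiable k (mollify \<eta> f)"
    if "smooth \<eta>" "\<forall>z. norm z > r \<longrightarrow> \<eta> z = 0" for k \<eta>
    using that
  proof (induction k arbitrary: \<eta>)
    case 0
    then show ?case
      using has_derivative_continuous[OF mollify_has_derivative[OF assms(1), of \<eta> r]]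
      by (auto intro!: continuous_at_imp_continuous_on)
  next
    case (Suc k)
    have "mollify \<eta> f differentiable (at x)" for x
      using mollify_has_derivative[OF assms(1) Suc.prems] differentiableI by blast
    moreover have "continuously_differentiable k (partial_deriv b (mollify \<eta> f))" if "b \<in> Basis" for b
      unfolding partial_deriv_mollify[OF assms(1) Suc.prems that]
      by (intro Suc.IH smooth_partial_deriv[OF Suc.prems(1) that] partial_deriv_support[OF Suc.prems(2)])
    ultimately show ?case by simp
  qed
  then show ?thesis using assms unfolding smooth_def by blast
qed

text \<open>The reflected kernel is a test function. Reflection and the definition of the weak
  gradient each contribute a minus sign, and these cancel.\<close>

lemma partial_deriv_mollify_weak:
  fixes f \<eta> :: "'a::euclidean_space \<Rightarrow> real"
  assumes f: "locally_integrable f" and G: "has_weak_gradient f G" and \<eta>: "smooth \<eta>"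
    and supp: "\<forall>z. norm z > r \<longrightarrow> \<eta> z = 0" and b: "b \<in> Basis"
  shows "partial_deriv b (mollify \<eta> f) x = mollify \<eta> (\<lambda>y. G y \<bullet> b) x"
proof -
  \<comment> \<open>The factor 1 gives the shape \<open>c * u (x - y)\<close> of the reflection
    lemmas.\<close>
  let ?u = "\<lambda>y. 1 * \<eta> (x - y)"
  have "closure {y. ?u y \<noteq> 0} \<subseteq> cball x r"
  proof (rule closure_minimal)
    show "{y. ?u y \<noteq> 0} \<subseteq> cball x r"
    proof
      fix y assume "y \<in> {y. ?u y \<noteq> 0}"
      then have "\<not> norm (x - y) > r" using supp by auto
      then show "y \<in> cball x r" by (simp add: dist_norm)
    qed
  qed simp
  then have "compact (closure {y. ?u y \<noteq> 0})"
    using bounded_subset[OF bounded_cball] by (simp add: compact_eq_bounded_closed)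
  then have "test_function ?u"
    using smooth_reflect[OF \<eta>, of 1 x] by (simp add: test_function_def)
  then have "(LINT y|lebesgue. f y * partial_deriv b ?u y) = - (LINT y|lebesgue. (G y \<bullet> b) * ?u y)"
    using G b unfolding has_weak_gradient_def by blast
  then have "(LINT y|lebesgue. f y * partial_deriv b \<eta> (x - y)) = (LINT y|lebesgue. (G y \<bullet> b) * \<eta> (x - y))"
    unfolding partial_deriv_reflect[OF \<eta> b] by simp
  then show ?thesis
    unfolding partial_deriv_mollify[OF f \<eta> supp b] by (simp add: mollify_def)
qed

text \<open>Clip \<open>f\<close> at a large level, take continuous functions converging to the
  clipped \<open>f\<close> off a null set, and clip these as well: the level then dominates them all
  on a ball of finite volume. Each of the two replacements costs at most e / 2.\<close>

lemma locally_integrable_approx_continuous: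
  fixes f :: "'a::euclidean_space \<Rightarrow> real"
  assumes f: "locally_integrable f" and e: "e > 0"
  shows "\<exists>g. continuous_on UNIV g \<and> (\<integral>\<^sup>+x\<in>ball 0 R. ennreal \<bar>f x - g x\<bar> \<partial>lebesgue) \<le> ennreal e"
proof -
  let ?B = "ball (0::'a) R"
  define cl where "cl = (\<lambda>(M::nat) (v::real). max (- real M) (min (real M) v))"
  have cl_le: "\<bar>cl M v\<bar> \<le> \<bar>v\<bar>" "\<bar>cl M v\<bar> \<le> M" for M v by (auto simp: cl_def)
  have [measurable]: "f \<in> borel_measurable lebesgue" by (rule locally_integrable_measurable[OF f])
  have [measurable]: "?B \<in> sets lebesgue" by simp
  have cl_meas [measurable]: "(\<lambda>x. cl M (h x)) \<in> borel_measurable lebesgue"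
    if "h \<in> borel_measurable lebesgue" for M and h :: "'a \<Rightarrow> real"
    using that unfolding cl_def by measurable
  have fin: "(\<integral>\<^sup>+x. ennreal (indicator ?B x * \<bar>f x\<bar>) \<partial>lebesgue) < \<infinity>"
  proof -
    have "ennreal (indicator ?B x * \<bar>f x\<bar>) = ennreal (norm (f x)) * indicator ?B x" for x
      by (simp add: indicator_def)
    then show ?thesis using locally_integrable_nn_integral[OF f bounded_ball, of 0 R] by simp
  qed
  have "(\<lambda>M. \<integral>\<^sup>+x. norm (indicator ?B x * f x - indicator ?B x * cl M (f x)) \<partial>lebesgue) \<longlonglongrightarrow> 0"
  proof (rule nn_integral_dominated_convergence_norm)
    show "AE x in lebesgue. norm (indicator ?B x * cl M (f x)) \<le> indicator ?B x * \<bar>f x\<bar>" for M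
      by (rule AE_I2) (simp add: abs_mult mult_left_mono cl_le)
    show "AE x in lebesgue. (\<lambda>M. indicator ?B x * cl M (f x)) \<longlonglongrightarrow> indicator ?B x * f x"
    proof (rule AE_I2, rule tendsto_mult_left, rule tendsto_eventually)
      fix x
      obtain N :: nat where "\<bar>f x\<bar> \<le> N" using real_arch_simple by blast
      then show "\<forall>\<^sub>F M in sequentially. cl M (f x) = f x"
        unfolding eventually_sequentially by (intro exI[of _ N]) (auto simp: cl_def)
    qed
  qed (use fin in auto)
  from order_tendstoD(2)[OF this, of "ennreal (e / 2)"] e
  obtain M where M: "(\<integral>\<^sup>+x. norm (indicator ?B x * f x - indicator ?B x * cl M (f x)) \<partial>lebesgue) < ennreal (e / 2)"
    by (auto simp: eventually_sequentially)
  \<comment> \<open>By definition, \<open>measurable_on\<close> supplies continuous functions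
    converging off a negligible set.\<close>
  have "(\<lambda>x. cl M (f x)) measurable_on UNIV"
    by (rule lebesgue_measurable_imp_measurable_on) auto
  then obtain N g where N: "negligible N" and g: "\<And>n. continuous_on UNIV (g n)"
    and lim: "\<And>x. x \<notin> N \<Longrightarrow> (\<lambda>n. g n x) \<longlonglongrightarrow> cl M (f x)"
    by (auto simp: measurable_on_def)
  have cont: "continuous_on UNIV (\<lambda>x. cl M (g n x))" for n
    unfolding cl_def by (intro continuous_intros g)
  have "(\<lambda>n. \<integral>\<^sup>+x. norm (indicator ?B x * cl M (f x) - indicator ?B x * cl M (g n x)) \<partial>lebesgue) \<longlonglongrightarrow> 0"
  proof (rule nn_integral_dominated_convergence_norm)
    show "(\<lambda>x. indicator ?B x * cl M (g n x)) \<in> borel_measurable lebesgue" for n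
      using continuous_lebesgue_measurable[OF cont[of n]] by measurable
    show "AE x in lebesgue. norm (indicator ?B x * cl M (g n x)) \<le> indicator ?B x * real M" for n
      by (rule AE_I2) (simp add: abs_mult mult_left_mono cl_le)
    show "(\<integral>\<^sup>+x. ennreal (indicator ?B x * real M) \<partial>lebesgue) < \<infinity>"
    proof -
      have "(\<integral>\<^sup>+x. ennreal (indicator ?B x * real M) \<partial>lebesgue) = (\<integral>\<^sup>+x. ennreal M * indicator ?B x \<partial>lebesgue)"
        by (intro nn_integral_cong) (simp add: indicator_def)
      also have "\<dots> = ennreal M * emeasure lborel ?B"
        by (subst nn_integral_cmult_indicator) auto
      also have "\<dots> < \<infinity>"
        using emeasure_bounded_finite[OF bounded_ball, of "0::'a" R] by (simp add: ennreal_mult_less_top)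
      finally show ?thesis .
    qed
    have "AE x in lebesgue. x \<notin> N"
      using N by (simp add: negligible_iff_null_sets AE_not_in)
    then show "AE x in lebesgue. (\<lambda>n. indicator ?B x * cl M (g n x)) \<longlonglongrightarrow> indicator ?B x * cl M (f x)"
    proof eventually_elim
      case (elim x)
      have "(\<lambda>n. cl M (g n x)) \<longlonglongrightarrow> cl M (cl M (f x))"
        unfolding cl_def by (intro tendsto_intros lim[OF elim, unfolded cl_def])
      moreover have "cl M (cl M (f x)) = cl M (f x)" by (auto simp: cl_def)
      ultimately show ?case by (intro tendsto_mult_left) simp
    qed
  qed auto
  from order_tendstoD(2)[OF this, of "ennreal (e / 2)"] e
  obtain n where n: "(\<integral>\<^sup>+x. norm (indicator ?B x * cl M (f x) - indicator ?B x * cl M (g n x)) \<partial>lebesgue) < ennreal (e / 2)"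
    by (auto simp: eventually_sequentially)
  have [measurable]: "(\<lambda>x. cl M (g n x)) \<in> borel_measurable lebesgue"
    by (rule continuous_lebesgue_measurable[OF cont])
  have "(\<integral>\<^sup>+x\<in>?B. ennreal \<bar>f x - cl M (g n x)\<bar> \<partial>lebesgue) \<le>
      (\<integral>\<^sup>+x. ennreal (norm (indicator ?B x * f x - indicator ?B x * cl M (f x))) +
         ennreal (norm (indicator ?B x * cl M (f x) - indicator ?B x * cl M (g n x))) \<partial>lebesgue)"
    by (intro nn_integral_mono) (auto simp: indicator_def ennreal_plus[symmetric] simp del: ennreal_plus intro!: ennreal_leI)
  also have "\<dots> = (\<integral>\<^sup>+x. norm (indicator ?B x * f x - indicator ?B x * cl M (f x)) \<partial>lebesgue) +
      (\<integral>\<^sup>+x. norm (indicator ?B x * cl M (f x) - indicator ?B x * cl M (g n x)) \<partial>lebesgue)"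
    by (rule nn_integral_add) measurable
  also have "\<dots> \<le> ennreal (e / 2) + ennreal (e / 2)"
    using M n by (intro add_mono) auto
  also have "\<dots> = ennreal e" using e by (simp add: ennreal_plus[symmetric] del: ennreal_plus)
  finally show ?thesis using cont by blast
qed

lemma mollifier_support:
  assumes "mollifier r \<eta>"
  shows "smooth \<eta>" "\<forall>z. norm z > r \<longrightarrow> \<eta> z = 0"
  using assms by (auto simp: mollifier_def)

lemma mollifier_reflect:
  fixes \<eta> :: "'a::euclidean_space \<Rightarrow> real"
  assumes "mollifier r \<eta>"
  shows "(\<integral>\<^sup>+y. ennreal (\<eta> (x - y)) \<partial>lebesgue) = 1"
    and "has_bochner_integral lebesgue (\<lambda>y. \<eta> (x - y)) 1"
proof -
  have [measurable]: "\<eta> \<in> borel_measurable borel"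
    using assms by (intro borel_measurable_continuous_onI smooth_continuous_on) (simp add: mollifier_def)
  show 1: "(\<integral>\<^sup>+y. ennreal (\<eta> (x - y)) \<partial>lebesgue) = 1"
    using assms nn_integral_lborel_reflect[of "\<lambda>y. ennreal (\<eta> y)" x]
    by (simp add: mollifier_def nn_integral_completion)
  have "(\<lambda>y. \<eta> (x - y)) \<in> borel_measurable lebesgue"
    by (rule measurable_completion) simp
  then show "has_bochner_integral lebesgue (\<lambda>y. \<eta> (x - y)) 1"
    by (rule has_bochner_integral_nn_integral) (use 1 assms in \<open>auto simp: mollifier_def\<close>)
qed

text \<open>Stated for all mollifiers of small radius, so that one \<open>\<eta>\<close> can later
  serve \<open>f\<close> and every component of the gradient. With a continuous \<open>g\<close>
  close to \<open>f\<close>, the error splits into the mollified |f - g|, the oscillation of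
  \<open>g\<close> at scale r, and |f - g| itself; each takes e / 3.\<close>

lemma mollify_L1_approx:
  fixes f :: "'a::euclidean_space \<Rightarrow> real"
  assumes f: "locally_integrable f" and e: "e > 0"
  shows "\<forall>\<^sub>F r in at_right 0. \<forall>\<eta>. mollifier r \<eta> \<longrightarrow>
    (\<integral>\<^sup>+x\<in>ball 0 R. ennreal \<bar>mollify \<eta> f x - f x\<bar> \<partial>lebesgue) \<le> ennreal e"
proof -
  define vol where "vol = measure lborel (ball (0::'a) R)"
  have vol: "vol \<ge> 0" by (simp add: vol_def)
  \<comment> \<open>Integrating a pointwise oscillation below \<open>e'\<close> over the ball
    multiplies it by \<open>vol\<close>.\<close>
  define e' where "e' = e / 3 / (vol + 1)"
  have e': "e' > 0" "e' * vol \<le> e / 3" using e vol by (auto simp: e'_def field_simps)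
  \<comment> \<open>On the ball of radius \<open>R\<close>, a mollification of radius below 1 sees
    \<open>f\<close> only within radius \<open>R + 1\<close>.\<close>
  obtain g where g: "continuous_on UNIV g"
    and fg: "(\<integral>\<^sup>+x\<in>ball 0 (R + 1). ennreal \<bar>f x - g x\<bar> \<partial>lebesgue) \<le> ennreal (e / 3)"
    using locally_integrable_approx_continuous[OF f, of "e / 3" "R + 1"] e by auto
  have "uniformly_continuous_on (cball 0 (R + 1)) g"
    by (intro compact_uniformly_continuous continuous_on_subset[OF g]) auto
  then obtain d where "d > 0" and d: "\<forall>x\<in>cball 0 (R + 1). \<forall>y\<in>cball 0 (R + 1). dist y x < d \<longrightarrow> dist (g y) (g x) < e'"
    using e' unfolding uniformly_continuous_on_def by blast
  have [measurable]: "f \<in> borel_measurable lebesgue" by (rule locally_integrable_measurable[OF f])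
  have [measurable]: "g \<in> borel_measurable lebesgue" by (rule continuous_lebesgue_measurable[OF g])
  have [measurable]: "ball (0::'a) \<rho> \<in> sets lebesgue" for \<rho> by simp
  define F where "F = (\<lambda>x. ennreal \<bar>f x - g x\<bar>)"
  have [measurable]: "F \<in> borel_measurable lebesgue" unfolding F_def by measurable
  have "(\<integral>\<^sup>+x\<in>ball 0 R. ennreal \<bar>mollify \<eta> f x - f x\<bar> \<partial>lebesgue) \<le> ennreal e"
    if \<eta>: "mollifier r \<eta>" and r: "r < min d 1" for r and \<eta> :: "'a \<Rightarrow> real"
  proof -
    have \<eta>0: "\<eta> z \<ge> 0" and supp: "\<eta> z \<noteq> 0 \<Longrightarrow> norm z < r" for z using \<eta> by (auto simp: mollifier_def)
    have \<eta>c: "continuous_on UNIV \<eta>" using \<eta> by (auto simp: mollifier_def intro: smooth_continuous_on)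
    then have [measurable]: "\<eta> \<in> borel_measurable borel" by (rule borel_measurable_continuous_onI)
    have \<eta>l [measurable]: "(\<lambda>y. \<eta> (x - y)) \<in> borel_measurable lebesgue" for x
      by (rule measurable_completion) simp
    note one = mollifier_reflect[OF \<eta>]
    \<comment> \<open>On the ball of radius \<open>R\<close> this dominates the mollification of f -
      g; as \<open>\<eta>\<close> has mass 1, its integral is that of |f - g| over the larger
      ball.\<close>
    define A where "A = (\<lambda>x. \<integral>\<^sup>+y. ennreal (\<eta> (x - y)) * (F y * indicator (ball 0 (R + 1)) y) \<partial>lebesgue)"
    have A_int: "(\<integral>\<^sup>+x. A x \<partial>lebesgue) = (\<integral>\<^sup>+y\<in>ball 0 (R + 1). F y \<partial>lebesgue)"
      and A_meas [measurable]: "A \<in> borel_measurable lebesgue"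
    proof -
      have meas: "(\<lambda>y. F y * indicator (ball 0 (R + 1)) y) \<in> borel_measurable lebesgue" by measurable
      have "(\<integral>\<^sup>+x. ennreal (\<eta> x) \<partial>lborel) = 1" using \<eta> by (simp add: mollifier_def)
      then show "(\<integral>\<^sup>+x. A x \<partial>lebesgue) = (\<integral>\<^sup>+y\<in>ball 0 (R + 1). F y \<partial>lebesgue)"
        unfolding A_def using nn_integral_convolution(2)[OF meas, of "\<lambda>z. ennreal (\<eta> z)"] by simp
      show "A \<in> borel_measurable lebesgue"
        unfolding A_def using nn_integral_convolution(1)[OF meas, of "\<lambda>z. ennreal (\<eta> z)"]
        by (intro measurable_completion) simp
    qed
    have ptw: "ennreal \<bar>mollify \<eta> f x - f x\<bar> \<le> A x + (ennreal e' + F x)" if x: "x \<in> ball 0 R" for x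
    proof -
      have i1: "integrable lebesgue (\<lambda>y. f y * \<eta> (x - y))"
        by (rule mollify_integrable[OF f \<eta>c mollifier_support(2)[OF \<eta>]])
      have i2: "integrable lebesgue (\<lambda>y. f x * \<eta> (x - y))"
        using one(2) by (simp add: has_bochner_integral_iff)
      have eq: "mollify \<eta> f x - f x = (LINT y|lebesgue. f y * \<eta> (x - y) - f x * \<eta> (x - y))"
        using i1 i2 has_bochner_integral_integral_eq[OF one(2), of x] by (simp add: mollify_def)
      have "ennreal \<bar>mollify \<eta> f x - f x\<bar> \<le> (\<integral>\<^sup>+y. norm (f y * \<eta> (x - y) - f x * \<eta> (x - y)) \<partial>lebesgue)"
        unfolding eq real_norm_def[symmetric]
        by (rule integral_norm_bound_ennreal) (intro Bochner_Integration.integrable_diff i1 i2)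
      also have "\<dots> \<le> (\<integral>\<^sup>+y. ennreal (\<eta> (x - y)) * (F y * indicator (ball 0 (R + 1)) y) +
          ennreal (\<eta> (x - y)) * (ennreal e' + F x) \<partial>lebesgue)"
      proof (rule nn_integral_mono)
        fix y
        show "ennreal (norm (f y * \<eta> (x - y) - f x * \<eta> (x - y))) \<le>
          ennreal (\<eta> (x - y)) * (F y * indicator (ball 0 (R + 1)) y) + ennreal (\<eta> (x - y)) * (ennreal e' + F x)"
        proof (cases "\<eta> (x - y) = 0")
          case False
          then have xy: "norm (x - y) < d" "norm (x - y) < 1" using supp[of "x - y"] r by auto
          have "norm y \<le> norm x + norm (x - y)" using norm_triangle_ineq4[of x "x - y"] by simp
          then have y: "y \<in> ball 0 (R + 1)" using xy x by simp
          then have "y \<in> cball 0 (R + 1)" "x \<in> cball 0 (R + 1)" using x by auto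
          then have "\<bar>g y - g x\<bar> < e'" using d xy by (auto simp: dist_norm norm_minus_commute)
          then have "\<bar>f y - f x\<bar> \<le> \<bar>f y - g y\<bar> + (e' + \<bar>f x - g x\<bar>)" by linarith
          then have "\<eta> (x - y) * \<bar>f y - f x\<bar> \<le> \<eta> (x - y) * (\<bar>f y - g y\<bar> + (e' + \<bar>f x - g x\<bar>))"
            using \<eta>0 by (rule mult_left_mono)
          then have "ennreal (\<eta> (x - y) * \<bar>f y - f x\<bar>) \<le> ennreal (\<eta> (x - y) * (\<bar>f y - g y\<bar> + (e' + \<bar>f x - g x\<bar>)))"
            by (rule ennreal_leI)
          also have "\<dots> = ennreal (\<eta> (x - y)) * F y + ennreal (\<eta> (x - y)) * (ennreal e' + F x)"
            using \<eta>0[of "x - y"] e' by (simp add: F_def ennreal_mult distrib_left)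
          finally show ?thesis
            using y \<eta>0[of "x - y"] by (simp add: abs_mult left_diff_distrib[symmetric] mult.commute)
        qed simp
      qed
      also have "\<dots> = A x + (\<integral>\<^sup>+y. ennreal (\<eta> (x - y)) * (ennreal e' + F x) \<partial>lebesgue)"
        unfolding A_def by (rule nn_integral_add) measurable
      also have "(\<integral>\<^sup>+y. ennreal (\<eta> (x - y)) * (ennreal e' + F x) \<partial>lebesgue) = ennreal e' + F x"
        by (subst nn_integral_multc) (auto simp: one(1))
      finally show ?thesis .
    qed
    have "(\<integral>\<^sup>+x\<in>ball 0 R. ennreal \<bar>mollify \<eta> f x - f x\<bar> \<partial>lebesgue) \<le>
        (\<integral>\<^sup>+x. A x + (ennreal e' * indicator (ball 0 R) x + F x * indicator (ball 0 (R + 1)) x) \<partial>lebesgue)"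
    proof (rule nn_integral_mono)
      fix x
      show "ennreal \<bar>mollify \<eta> f x - f x\<bar> * indicator (ball 0 R) x \<le>
        A x + (ennreal e' * indicator (ball 0 R) x + F x * indicator (ball 0 (R + 1)) x)"
      proof (cases "x \<in> ball 0 R")
        case True
        then have "x \<in> ball 0 (R + 1)" by simp
        then show ?thesis using ptw[OF True] True by simp
      qed simp
    qed
    also have "\<dots> = (\<integral>\<^sup>+x. A x \<partial>lebesgue) + ((\<integral>\<^sup>+x. ennreal e' * indicator (ball (0::'a) R) x \<partial>lebesgue) +
        (\<integral>\<^sup>+x\<in>ball 0 (R + 1). F x \<partial>lebesgue))"
    proof -
      have m: "(\<lambda>x::'a. ennreal e' * indicator (ball 0 R) x) \<in> borel_measurable lebesgue"
        "(\<lambda>x::'a. F x * indicator (ball 0 (R + 1)) x) \<in> borel_measurable lebesgue" by measurable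
      show ?thesis
        unfolding nn_integral_add[OF A_meas borel_measurable_add[OF m]] nn_integral_add[OF m] ..
    qed
    also have "(\<integral>\<^sup>+x. ennreal e' * indicator (ball (0::'a) R) x \<partial>lebesgue) = ennreal (e' * vol)"
      using e' emeasure_bounded_finite[OF bounded_ball, of "0::'a" R]
      by (subst nn_integral_cmult_indicator)
        (auto simp: vol_def ennreal_mult emeasure_eq_ennreal_measure less_top[symmetric])
    also have "(\<integral>\<^sup>+x. A x \<partial>lebesgue) + (ennreal (e' * vol) + (\<integral>\<^sup>+x\<in>ball 0 (R + 1). F x \<partial>lebesgue)) \<le>
        ennreal (e / 3) + (ennreal (e / 3) + ennreal (e / 3))"
      unfolding A_int using fg e' by (intro add_mono ennreal_leI) (auto simp: F_def)
    also have "\<dots> = ennreal e" using e by (simp add: ennreal_plus[symmetric] del: ennreal_plus)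
    finally show ?thesis .
  qed
  then show ?thesis
    using \<open>d > 0\<close> by (intro eventually_at_rightI[of 0 "min d 1"] allI impI) simp_all
qed

text \<open>A form of the fundamental lemma of the calculus of variations: mollifications
  approximate \<open>D\<close> in L^1 of each ball, and here they are all 0.\<close>

lemma mollify_zero_imp_AE_zero:
  fixes D :: "'a::euclidean_space \<Rightarrow> real"
  assumes D: "locally_integrable D" and 0: "\<And>r \<eta> x. mollifier r \<eta> \<Longrightarrow> mollify \<eta> D x = 0"
  shows "AE x in lebesgue. D x = 0"
proof -
  have [measurable]: "D \<in> borel_measurable lebesgue" by (rule locally_integrable_measurable[OF D])
  have [measurable]: "ball (0::'a) \<rho> \<in> sets lebesgue" for \<rho> by simp
  have "AE x in lebesgue. x \<in> ball 0 (real n) \<longrightarrow> D x = 0" for n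
  proof -
    have "(\<integral>\<^sup>+x\<in>ball 0 (real n). ennreal \<bar>D x\<bar> \<partial>lebesgue) \<le> 0 + ennreal e" if e: "e > 0" for e
    proof -
      from eventually_happens'[OF trivial_limit_at_right_real
          eventually_conj[OF eventually_at_right_less[of "0::real"] mollify_L1_approx[OF D e, of "real n"]]]
      obtain r where r: "r > 0" "\<forall>\<eta>. mollifier r \<eta> \<longrightarrow>
          (\<integral>\<^sup>+x\<in>ball 0 (real n). ennreal \<bar>mollify \<eta> D x - D x\<bar> \<partial>lebesgue) \<le> ennreal e"
        by blast
      obtain \<eta> :: "'a \<Rightarrow> real" where \<eta>: "mollifier r \<eta>" using mollifier_exists[OF r(1)] by blast
      then have "(\<integral>\<^sup>+x\<in>ball 0 (real n). ennreal \<bar>mollify \<eta> D x - D x\<bar> \<partial>lebesgue) \<le> ennreal e"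
        using r(2) by blast
      then show ?thesis by (simp add: 0[OF \<eta>])
    qed
    then have "(\<integral>\<^sup>+x\<in>ball 0 (real n). ennreal \<bar>D x\<bar> \<partial>lebesgue) \<le> 0"
      by (rule ennreal_le_epsilon)
    then have "(\<integral>\<^sup>+x\<in>ball 0 (real n). ennreal \<bar>D x\<bar> \<partial>lebesgue) = 0" by simp
    then have "AE x in lebesgue. ennreal \<bar>D x\<bar> * indicator (ball 0 (real n)) x = 0"
      by (subst (asm) nn_integral_0_iff_AE) auto
    then show ?thesis by eventually_elim (auto simp: indicator_def split: if_splits)
  qed
  then have "AE x in lebesgue. \<forall>n. x \<in> ball 0 (real n) \<longrightarrow> D x = 0"
    by (subst AE_all_countable) blast
  then show ?thesis
  proof eventually_elim
    case (elim x)
    obtain n :: nat where "norm x < n" using reals_Archimedean2 by blast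
    then show ?case using elim by auto
  qed
qed

text \<open>A trace may be witnessed by another weak gradient than the given one. Both mollify to
  the classical gradient of the mollified \<open>f\<close>, so every mollification of their
  difference vanishes.\<close>

lemma weak_gradient_unique:
  fixes f :: "'a::euclidean_space \<Rightarrow> real"
  assumes f: "locally_integrable f" and G: "has_weak_gradient f G" and H: "has_weak_gradient f H"
  shows "AE x in lebesgue. G x = H x"
proof -
  have lG: "locally_integrable (\<lambda>x. G x \<bullet> b)" and lH: "locally_integrable (\<lambda>x. H x \<bullet> b)" for b
    using G H unfolding has_weak_gradient_def by (blast intro: locally_integrable_inner)+
  have "AE x in lebesgue. G x \<bullet> b - H x \<bullet> b = 0" if b: "b \<in> Basis" for b
  proof (rule mollify_zero_imp_AE_zero)
    show "locally_integrable (\<lambda>x. G x \<bullet> b - H x \<bullet> b)"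
      using lG[of b] lH[of b] set_integral_diff(1) unfolding locally_integrable_def by blast
    fix r x and \<eta> :: "'a \<Rightarrow> real" assume \<eta>: "mollifier r \<eta>"
    note supp = mollifier_support[OF \<eta>]
    have "mollify \<eta> (\<lambda>x. G x \<bullet> b) x = mollify \<eta> (\<lambda>x. H x \<bullet> b) x"
      using partial_deriv_mollify_weak[OF f G supp b, of x] partial_deriv_mollify_weak[OF f H supp b, of x] by simp
    moreover have "mollify \<eta> (\<lambda>x. G x \<bullet> b - H x \<bullet> b) x = mollify \<eta> (\<lambda>x. G x \<bullet> b) x - mollify \<eta> (\<lambda>x. H x \<bullet> b) x"
      unfolding mollify_def left_diff_distrib
      by (intro Bochner_Integration.integral_diff
          mollify_integrable[OF lG smooth_continuous_on[OF supp(1)] supp(2)]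
          mollify_integrable[OF lH smooth_continuous_on[OF supp(1)] supp(2)])
    ultimately show "mollify \<eta> (\<lambda>x. G x \<bullet> b - H x \<bullet> b) x = 0" by simp
  qed
  then have "AE x in lebesgue. \<forall>b\<in>Basis. G x \<bullet> b - H x \<bullet> b = 0"
    by (intro AE_finite_allI) auto
  then show ?thesis by eventually_elim (rule euclidean_eqI, simp)
qed

text \<open>A single mollifier serves both estimates, because the gradient of the mollified
  \<open>f\<close> is the mollified \<open>G\<close>, component by component.\<close>

lemma smooth_approximation:
  fixes f :: "'a::euclidean_space \<Rightarrow> real"
  assumes f: "locally_integrable f" and G: "has_weak_gradient f G" and e: "e > 0"
  shows "\<exists>u. smooth u \<and> (\<integral>\<^sup>+x\<in>ball 0 R. ennreal \<bar>u x - f x\<bar> \<partial>lebesgue) \<le> ennreal e \<and>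
    (\<integral>\<^sup>+x\<in>ball 0 R. ennreal (norm (gradient u x - G x)) \<partial>lebesgue) \<le> ennreal e"
proof -
  have lG: "locally_integrable (\<lambda>x. G x \<bullet> b)" for b
    using G by (auto simp: has_weak_gradient_def intro: locally_integrable_inner)
  have G_meas [measurable]: "G \<in> borel_measurable lebesgue"
    using G by (auto simp: has_weak_gradient_def intro: locally_integrable_measurable)
  have [measurable]: "ball (0::'a) \<rho> \<in> sets lebesgue" for \<rho> by simp
  \<comment> \<open>The Euclidean norm is bounded by the sum of the n absolute components.\<close>
  define e' where "e' = e / DIM('a)"
  have e': "e' > 0" using e by (simp add: e'_def)
  have "\<forall>\<^sub>F r in at_right 0. \<forall>b\<in>Basis. \<forall>\<eta>. mollifier r \<eta> \<longrightarrow>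
      (\<integral>\<^sup>+x\<in>ball 0 R. ennreal \<bar>mollify \<eta> (\<lambda>x. G x \<bullet> b) x - G x \<bullet> b\<bar> \<partial>lebesgue) \<le> ennreal e'"
    by (intro eventually_ball_finite ballI mollify_L1_approx[OF lG e']) simp
  from eventually_happens'[OF trivial_limit_at_right_real eventually_conj[OF
      eventually_at_right_less[of "0::real"] eventually_conj[OF this mollify_L1_approx[OF f e, of R]]]]
  obtain r where r: "r > 0" and bounds: "\<forall>b\<in>Basis. \<forall>\<eta>. mollifier r \<eta> \<longrightarrow>
      (\<integral>\<^sup>+x\<in>ball 0 R. ennreal \<bar>mollify \<eta> (\<lambda>x. G x \<bullet> b) x - G x \<bullet> b\<bar> \<partial>lebesgue) \<le> ennreal e'"
      "\<forall>\<eta>. mollifier r \<eta> \<longrightarrow> (\<integral>\<^sup>+x\<in>ball 0 R. ennreal \<bar>mollify \<eta> f x - f x\<bar> \<partial>lebesgue) \<le> ennreal e"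
    by blast
  obtain \<eta> :: "'a \<Rightarrow> real" where \<eta>: "mollifier r \<eta>" using mollifier_exists[OF r] by blast
  note supp = mollifier_support[OF \<eta>]
  let ?u = "mollify \<eta> f"
  have u: "smooth ?u" by (rule smooth_mollify[OF f supp])
  have [measurable]: "gradient ?u \<in> borel_measurable lebesgue"
    by (rule continuous_lebesgue_measurable[OF continuous_on_gradient[OF u]])
  have "(\<integral>\<^sup>+x\<in>ball 0 R. ennreal (norm (gradient ?u x - G x)) \<partial>lebesgue) \<le>
      (\<integral>\<^sup>+x. (\<Sum>b\<in>Basis. ennreal \<bar>mollify \<eta> (\<lambda>x. G x \<bullet> b) x - G x \<bullet> b\<bar> * indicator (ball 0 R) x) \<partial>lebesgue)"
  proof (rule nn_integral_mono)
    fix x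
    have "norm (gradient ?u x - G x) \<le> (\<Sum>b\<in>Basis. \<bar>(gradient ?u x - G x) \<bullet> b\<bar>)" by (rule norm_le_l1)
    also have "\<dots> = (\<Sum>b\<in>Basis. \<bar>mollify \<eta> (\<lambda>x. G x \<bullet> b) x - G x \<bullet> b\<bar>)"
      by (intro sum.cong)
        (auto simp: inner_diff_left inner_gradient_Basis partial_deriv_mollify_weak[OF f G supp])
    finally have "ennreal (norm (gradient ?u x - G x)) \<le> (\<Sum>b\<in>Basis. ennreal \<bar>mollify \<eta> (\<lambda>x. G x \<bullet> b) x - G x \<bullet> b\<bar>)"
      by (simp add: ennreal_leI)
    then show "ennreal (norm (gradient ?u x - G x)) * indicator (ball 0 R) x \<le>
      (\<Sum>b\<in>Basis. ennreal \<bar>mollify \<eta> (\<lambda>x. G x \<bullet> b) x - G x \<bullet> b\<bar> * indicator (ball 0 R) x)"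
      by (simp add: indicator_def)
  qed
  also have "\<dots> = (\<Sum>b\<in>Basis. \<integral>\<^sup>+x. ennreal \<bar>mollify \<eta> (\<lambda>x. G x \<bullet> b) x - G x \<bullet> b\<bar> * indicator (ball 0 R) x \<partial>lebesgue)"
  proof (rule nn_integral_sum)
    fix b :: 'a assume "b \<in> Basis"
    have "mollify \<eta> (\<lambda>x. G x \<bullet> b) \<in> borel_measurable lebesgue"
      by (rule continuous_lebesgue_measurable[OF smooth_continuous_on[OF smooth_mollify[OF lG supp]]])
    then show "(\<lambda>x. ennreal \<bar>mollify \<eta> (\<lambda>x. G x \<bullet> b) x - G x \<bullet> b\<bar> * indicator (ball 0 R) x) \<in> borel_measurable lebesgue"
      by measurable
  qed
  also have "\<dots> \<le> (\<Sum>b\<in>(Basis :: 'a set). ennreal e')"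
    using bounds \<eta> by (intro sum_mono) blast
  also have "\<dots> = ennreal e" using e by (simp add: e'_def ennreal_of_nat_eq_real_of_nat ennreal_mult'[symmetric])
  finally show ?thesis using bounds \<eta> u by blast
qed

section \<open>Passage to the limit\<close>

text \<open>Completeness of L^1 at a summable rate: the series of increments has finite integral,
  hence converges absolutely almost everywhere, and its tails bound the distance to the
  limit.\<close>

lemma L1_limit_of_geometric_Cauchy:
  fixes v :: "nat \<Rightarrow> 'a \<Rightarrow> real"
  assumes int: "\<And>k. integrable M (v k)" and C: "C \<ge> 0"
    and step: "\<And>k. (\<integral>\<^sup>+y. ennreal \<bar>v (Suc k) y - v k y\<bar> \<partial>M) \<le> ennreal (C * (1 / 2) ^ k)"
  shows "\<exists>h. integrable M h \<and> (\<lambda>k. \<integral>\<^sup>+y. ennreal \<bar>v k y - h y\<bar> \<partial>M) \<longlonglongrightarrow> 0"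
proof -
  have [measurable]: "v k \<in> borel_measurable M" for k using int[of k] by simp
  \<comment> \<open>On the null set of divergence \<open>lim\<close> has an unspecified value, but
    \<open>h\<close> is measurable all the same.\<close>
  define h where "h = (\<lambda>y. lim (\<lambda>k. v k y))"
  have [measurable]: "h \<in> borel_measurable M" unfolding h_def by measurable
  have geo: "(\<Sum>j. ennreal (C * (1 / 2) ^ (k + j))) = ennreal (2 * C * (1 / 2) ^ k)" for k
  proof (rule suminf_ennreal_eq)
    have "(\<lambda>j. C * (1 / 2) ^ k * (1 / 2) ^ j) sums (C * (1 / 2) ^ k * (1 / (1 - 1 / 2)))"
      by (intro sums_mult geometric_sums) simp
    then show "(\<lambda>j. C * (1 / 2) ^ (k + j)) sums (2 * C * (1 / 2) ^ k)"
      by (simp add: power_add mult_ac)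
  qed (use C in simp)
  have tail: "(\<integral>\<^sup>+y. (\<Sum>j. ennreal \<bar>v (Suc (k + j)) y - v (k + j) y\<bar>) \<partial>M) \<le> ennreal (2 * C * (1 / 2) ^ k)" for k
  proof -
    have "(\<integral>\<^sup>+y. (\<Sum>j. ennreal \<bar>v (Suc (k + j)) y - v (k + j) y\<bar>) \<partial>M) =
        (\<Sum>j. \<integral>\<^sup>+y. ennreal \<bar>v (Suc (k + j)) y - v (k + j) y\<bar> \<partial>M)"
      by (rule nn_integral_suminf) simp
    also have "\<dots> \<le> (\<Sum>j. ennreal (C * (1 / 2) ^ (k + j)))"
      by (intro suminf_le step) auto
    finally show ?thesis using geo by simp
  qed
  have "(\<integral>\<^sup>+y. (\<Sum>j. ennreal \<bar>v (Suc j) y - v j y\<bar>) \<partial>M) \<noteq> \<infinity>"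
    using tail[of 0] by (auto simp: top_unique)
  then have "AE y in M. (\<Sum>j. ennreal \<bar>v (Suc j) y - v j y\<bar>) \<noteq> \<infinity>"
    by (rule nn_integral_PInf_AE[rotated]) measurable
  then have lim: "AE y in M. (\<lambda>k. v k y) \<longlonglongrightarrow> h y"
  proof eventually_elim
    case (elim y)
    then have "summable (\<lambda>j. \<bar>v (Suc j) y - v j y\<bar>)"
      by (intro summable_suminf_not_top) auto
    then have "summable (\<lambda>j. v (Suc j) y - v j y)"
      by (rule summable_rabs_cancel)
    then have "convergent (\<lambda>m. v m y - v 0 y)"
      by (simp add: summable_iff_convergent sum_lessThan_telescope[of "\<lambda>m. v m y"])
    then have "convergent (\<lambda>m. v m y - v 0 y + v 0 y)"
      by (intro convergent_add convergent_const)
    then show ?case by (simp add: h_def convergent_LIMSEQ_iff)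
  qed
  have close: "(\<integral>\<^sup>+y. ennreal \<bar>v k y - h y\<bar> \<partial>M) \<le> ennreal (2 * C * (1 / 2) ^ k)" for k
  proof (rule order_trans[OF nn_integral_mono_AE tail[of k]])
    show "AE y in M. ennreal \<bar>v k y - h y\<bar> \<le> (\<Sum>j. ennreal \<bar>v (Suc (k + j)) y - v (k + j) y\<bar>)"
      using lim
    proof eventually_elim
      case (elim y)
      have L: "(\<lambda>m. ennreal \<bar>v k y - v (k + m) y\<bar>) \<longlonglongrightarrow> ennreal \<bar>v k y - h y\<bar>"
        using LIMSEQ_ignore_initial_segment[OF elim, of k] by (intro tendsto_intros) (simp add: add.commute)
      have le: "ennreal \<bar>v k y - v (k + m) y\<bar> \<le> (\<Sum>j. ennreal \<bar>v (Suc (k + j)) y - v (k + j) y\<bar>)" for m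
      proof -
        have "\<bar>v k y - v (k + m) y\<bar> = \<bar>\<Sum>j<m. v (Suc (k + j)) y - v (k + j) y\<bar>"
          using sum_lessThan_telescope[of "\<lambda>j. v (k + j) y" m] by simp
        also have "\<dots> \<le> (\<Sum>j<m. \<bar>v (Suc (k + j)) y - v (k + j) y\<bar>)" by (rule sum_abs)
        finally have "ennreal \<bar>v k y - v (k + m) y\<bar> \<le> (\<Sum>j<m. ennreal \<bar>v (Suc (k + j)) y - v (k + j) y\<bar>)"
          by (simp add: ennreal_leI)
        also have "\<dots> \<le> (\<Sum>j. ennreal \<bar>v (Suc (k + j)) y - v (k + j) y\<bar>)"
          by (rule sum_le_suminf) auto
        finally show ?thesis .
      qed
      show ?case
        by (rule LIMSEQ_le_const2[OF L]) (intro exI allI impI le)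
    qed
  qed
  have "(\<lambda>k. ennreal (2 * C * (1 / 2) ^ k)) \<longlonglongrightarrow> ennreal (2 * C * 0)"
    by (intro tendsto_intros LIMSEQ_power_zero) simp
  then have "(\<lambda>k. \<integral>\<^sup>+y. ennreal \<bar>v k y - h y\<bar> \<partial>M) \<longlonglongrightarrow> 0"
    by (intro tendsto_sandwich[OF _ always_eventually[OF allI[OF close]] tendsto_const]) simp_all
  moreover have "integrable M h"
  proof -
    have "(\<integral>\<^sup>+y. ennreal (norm (v 0 y - h y)) \<partial>M) < \<infinity>"
      using close[of 0] by (auto simp: less_top[symmetric] top_unique)
    then have "integrable M (\<lambda>y. v 0 y - h y)" by (intro integrableI_bounded) auto
    from Bochner_Integration.integrable_diff[OF int[of 0] this] show ?thesis by simp
  qed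
  ultimately show ?thesis by blast
qed

section \<open>Reflection of measurable functions, constants in square functions, and the dilated
  kernel\<close>

lemma borel_measurable_lebesgue_reflect:
  fixes F :: "'a::euclidean_space \<Rightarrow> 'b::euclidean_space"
  assumes "F \<in> borel_measurable lebesgue"
  shows "(\<lambda>y. F (x - y)) \<in> borel_measurable lebesgue"
proof -
  have "(\<lambda>y. F (x - y) \<bullet> b) \<in> borel_measurable lebesgue" if "b \<in> Basis" for b
  proof -
    have "(\<lambda>y. F y \<bullet> b) \<in> borel_measurable lebesgue" using assms by measurable
    then obtain g where g: "g \<in> borel_measurable lborel" and ae: "AE y in lborel. F y \<bullet> b = g y"
      using completion_ex_borel_measurable_real by blast
    have [measurable]: "g \<in> borel_measurable borel" using g by simp
    have "(\<lambda>y. g (x - y)) \<in> borel_measurable lebesgue" by (rule measurable_completion) simp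
    moreover have "AE y in lebesgue. g (x - y) = F (x - y) \<bullet> b"
      using AE_lebesgue_reflect[of "\<lambda>y. g y = F y \<bullet> b" x] ae by (simp add: AE_completion_iff eq_commute)
    ultimately show ?thesis by (rule borel_measurable_AE)
  qed
  then show ?thesis by (subst borel_measurable_euclidean_space) blast
qed

text \<open>Serves integrands in t whose measurability is never established. The supremum over
  simple functions gives one inequality for every constant and function; applied with 1 / c, it
  gives the converse.\<close>

lemma nn_integral_cmult_nonmeasurable:
  assumes "c > 0"
  shows "(\<integral>\<^sup>+x. ennreal c * f x \<partial>M) = ennreal c * (\<integral>\<^sup>+x. f x \<partial>M)"
proof -
  have le: "ennreal c * (\<integral>\<^sup>+x. f x \<partial>M) \<le> (\<integral>\<^sup>+x. ennreal c * f x \<partial>M)" for c f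
  proof -
    have "ennreal c * (\<integral>\<^sup>+x. f x \<partial>M) =
        (SUP g\<in>{g. simple_function M g \<and> g \<le> f}. \<integral>\<^sup>+x. ennreal c * g x \<partial>M)"
      unfolding nn_integral_def[of M f] SUP_mult_left_ennreal
      by (intro SUP_cong) (auto simp: nn_integral_cmult nn_integral_eq_simple_integral borel_measurable_simple_function)
    also have "\<dots> \<le> (\<integral>\<^sup>+x. ennreal c * f x \<partial>M)"
      by (intro SUP_least nn_integral_mono mult_left_mono) (auto simp: le_fun_def)
    finally show ?thesis .
  qed
  have "(\<integral>\<^sup>+x. ennreal c * f x \<partial>M) = ennreal c * (ennreal (1 / c) * (\<integral>\<^sup>+x. ennreal c * f x \<partial>M))"
    using assms by (simp add: mult.assoc[symmetric] ennreal_mult'[symmetric])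
  also have "\<dots> \<le> ennreal c * (\<integral>\<^sup>+x. ennreal (1 / c) * (ennreal c * f x) \<partial>M)"
    by (intro mult_left_mono le) simp
  also have "\<dots> = ennreal c * (\<integral>\<^sup>+x. f x \<partial>M)"
    using assms by (simp add: mult.assoc[symmetric] ennreal_mult'[symmetric])
  finally show ?thesis using le by (intro antisym)
qed

lemma ennreal_sqrt_mult_square:
  assumes "c > 0"
  shows "ennreal_sqrt (ennreal (c\<^sup>2) * a) = ennreal c * ennreal_sqrt a"
proof (cases a)
  case (real r)
  then show ?thesis
    using assms by (simp add: ennreal_sqrt_def ennreal_mult'[symmetric] ennreal_mult_eq_top_iff real_sqrt_mult)
next
  case top
  then show ?thesis
    using assms by (simp add: ennreal_sqrt_def ennreal_mult_top)
qed

lemma riesz_uminus: "riesz (- y) = - riesz y"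
  by (simp add: riesz_def)

text \<open>The kernel y / |y|^n is homogeneous of degree 1 - n, so the powers t^(-n) and t^(n-1)
  leave only 1 / t.\<close>

lemma dilate_phi:
  fixes y :: "'a::euclidean_space"
  assumes "t > 0"
  shows "dilate phi t y = (1 / (t * (DIM('a) * measure lborel (ball (0::'a) 1)))) *\<^sub>R (indicator (ball 0 t) y *\<^sub>R riesz y)"
proof -
  have ind: "indicator (ball 0 1) ((1 / t) *\<^sub>R y) = (indicator (ball 0 t) y :: real)"
    using assms by (simp add: indicator_def)
  show ?thesis
    unfolding dilate_def phi_def ind riesz_def
    using assms by (simp add: power_divide field_simps)
qed

text \<open>The balls grow with \<open>k\<close> because \<open>f\<close> and \<open>G\<close> are
  only locally integrable; every fixed ball is eventually covered. The geometric rate makes the sum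
  of the errors finite and the increments on each sphere summable.\<close>

locale fast_smooth_approximation =
  fixes f :: "'a::euclidean_space \<Rightarrow> real" and G :: "'a \<Rightarrow> 'a" and u :: "nat \<Rightarrow> 'a \<Rightarrow> real"
  assumes f: "locally_integrable f" and G: "has_weak_gradient f G" and u: "\<And>k. smooth (u k)"
    and u_le: "\<And>k. (\<integral>\<^sup>+x\<in>ball 0 (real k). ennreal \<bar>u k x - f x\<bar> \<partial>lebesgue) \<le> ennreal ((1 / 2) ^ k)"
    and grad_le: "\<And>k. (\<integral>\<^sup>+x\<in>ball 0 (real k). ennreal (norm (gradient (u k) x - G x)) \<partial>lebesgue) \<le> ennreal ((1 / 2) ^ k)"
begin

lemma measurability [measurable]:
  "f \<in> borel_measurable lebesgue" "G \<in> borel_measurable lebesgue"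
  "u k \<in> borel_measurable borel" "gradient (u k) \<in> borel_measurable borel"
  "u k \<in> borel_measurable lebesgue" "gradient (u k) \<in> borel_measurable lebesgue"
proof -
  show "f \<in> borel_measurable lebesgue" "G \<in> borel_measurable lebesgue"
    using f G by (simp_all add: has_weak_gradient_def locally_integrable_measurable)
  have c: "continuous_on UNIV (u k)" "continuous_on UNIV (gradient (u k))"
    by (rule smooth_continuous_on[OF u], rule continuous_on_gradient[OF u])
  show "u k \<in> borel_measurable borel" "gradient (u k) \<in> borel_measurable borel"
    "u k \<in> borel_measurable lebesgue" "gradient (u k) \<in> borel_measurable lebesgue"
    by (intro borel_measurable_continuous_onI continuous_lebesgue_measurable c)+
qed

lemma ball_lebesgue [measurable]: "ball (y::'a) r \<in> sets lebesgue"
  by simp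

lemma ball_subset:
  assumes "norm x + t \<le> real k"
  shows "ball x t \<subseteq> ball 0 (real k)"
proof
  fix y assume "y \<in> ball x t"
  then have "norm (y - x) < t" by (simp add: dist_norm norm_minus_commute)
  then show "y \<in> ball 0 (real k)" using assms norm_triangle_sub[of y x] by simp
qed

lemma ball_le:
  assumes "norm x + t \<le> real k"
  shows "(\<integral>\<^sup>+y\<in>ball x t. ennreal \<bar>u k y - f y\<bar> \<partial>lebesgue) \<le> ennreal ((1 / 2) ^ k)"
    and "(\<integral>\<^sup>+y\<in>ball x t. ennreal (norm (gradient (u k) y - G y)) \<partial>lebesgue) \<le> ennreal ((1 / 2) ^ k)"
proof -
  have ind: "indicator (ball x t) y \<le> (indicator (ball 0 (real k)) y :: ennreal)" for y
    using ball_subset[OF assms] by (auto simp: indicator_def)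
  show "(\<integral>\<^sup>+y\<in>ball x t. ennreal \<bar>u k y - f y\<bar> \<partial>lebesgue) \<le> ennreal ((1 / 2) ^ k)"
    by (rule order_trans[OF nn_integral_mono u_le]) (intro mult_left_mono ind, simp)
  show "(\<integral>\<^sup>+y\<in>ball x t. ennreal (norm (gradient (u k) y - G y)) \<partial>lebesgue) \<le> ennreal ((1 / 2) ^ k)"
    by (rule order_trans[OF nn_integral_mono grad_le]) (intro mult_left_mono ind, simp)
qed

lemma half_power_tendsto_0: "(\<lambda>k. ennreal ((1 / 2) ^ k)) \<longlonglongrightarrow> 0"
proof -
  have "(\<lambda>k. ennreal ((1 / 2) ^ k)) \<longlonglongrightarrow> ennreal 0"
    by (intro tendsto_ennrealI LIMSEQ_power_zero) simp
  then show ?thesis by simp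
qed

lemma ball_tendsto_0:
  "(\<lambda>k. \<integral>\<^sup>+y\<in>ball x t. ennreal \<bar>u k y - f y\<bar> \<partial>lebesgue) \<longlonglongrightarrow> 0"
  "(\<lambda>k. \<integral>\<^sup>+y\<in>ball x t. ennreal (norm (gradient (u k) y - G y)) \<partial>lebesgue) \<longlonglongrightarrow> 0"
proof -
  obtain N :: nat where N: "norm x + t \<le> real N" using real_arch_simple by blast
  have N': "norm x + t \<le> real k" if "k \<ge> N" for k using N that by linarith
  have ev: "\<forall>\<^sub>F k in sequentially. (\<integral>\<^sup>+y\<in>ball x t. ennreal \<bar>u k y - f y\<bar> \<partial>lebesgue) \<le> ennreal ((1 / 2) ^ k)"
    "\<forall>\<^sub>F k in sequentially. (\<integral>\<^sup>+y\<in>ball x t. ennreal (norm (gradient (u k) y - G y)) \<partial>lebesgue) \<le> ennreal ((1 / 2) ^ k)"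
    unfolding eventually_sequentially using ball_le[OF N'] by blast+
  show "(\<lambda>k. \<integral>\<^sup>+y\<in>ball x t. ennreal \<bar>u k y - f y\<bar> \<partial>lebesgue) \<longlonglongrightarrow> 0"
    by (rule tendsto_sandwich[OF _ ev(1) tendsto_const half_power_tendsto_0]) simp
  show "(\<lambda>k. \<integral>\<^sup>+y\<in>ball x t. ennreal (norm (gradient (u k) y - G y)) \<partial>lebesgue) \<longlonglongrightarrow> 0"
    by (rule tendsto_sandwich[OF _ ev(2) tendsto_const half_power_tendsto_0]) simp
qed

text \<open>The trace inequality for v - w, with \<open>f\<close> and its weak gradient inserted by
  the triangle inequality. Allowing another version \<open>H\<close> of \<open>G\<close> covers both
  uses: existence takes \<open>G\<close> itself, uniqueness the gradient that witnesses an arbitrary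
  trace.\<close>

lemma sphere_diff_le:
  assumes t: "t > 0" and v: "smooth v" and w: "smooth w" and H: "AE y in lebesgue. G y = H y"
  shows "(\<integral>\<^sup>+y. ennreal \<bar>v y - w y\<bar> \<partial>sphere_measure x t) \<le>
    ennreal (DIM('a) / t) * ((\<integral>\<^sup>+y\<in>ball x t. ennreal \<bar>v y - f y\<bar> \<partial>lebesgue) + (\<integral>\<^sup>+y\<in>ball x t. ennreal \<bar>w y - f y\<bar> \<partial>lebesgue)) +
    ((\<integral>\<^sup>+y\<in>ball x t. ennreal (norm (gradient v y - G y)) \<partial>lebesgue) + (\<integral>\<^sup>+y\<in>ball x t. ennreal (norm (gradient w y - H y)) \<partial>lebesgue))"
proof -
  have [measurable]: "v \<in> borel_measurable lebesgue" "w \<in> borel_measurable lebesgue"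
    "gradient v \<in> borel_measurable lebesgue" "gradient w \<in> borel_measurable lebesgue"
    using v w by (auto intro!: continuous_lebesgue_measurable smooth_continuous_on continuous_on_gradient)
  have "(\<integral>\<^sup>+y. ennreal \<bar>v y - w y\<bar> \<partial>sphere_measure x t) \<le>
    ennreal (DIM('a) / t) * (\<integral>\<^sup>+y\<in>ball x t. ennreal \<bar>v y - w y\<bar> \<partial>lebesgue) +
    (\<integral>\<^sup>+y\<in>ball x t. ennreal (norm (gradient v y - gradient w y)) \<partial>lebesgue)"
    using trace_inequality[OF smooth_diff[OF v w] t, of x] gradient_diff[OF v w]
    by (simp add: nn_integral_completion)
  also have "(\<integral>\<^sup>+y\<in>ball x t. ennreal \<bar>v y - w y\<bar> \<partial>lebesgue) \<le>
      (\<integral>\<^sup>+y. ennreal \<bar>v y - f y\<bar> * indicator (ball x t) y + ennreal \<bar>w y - f y\<bar> * indicator (ball x t) y \<partial>lebesgue)"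
    by (intro nn_integral_mono)
      (auto simp: indicator_def ennreal_plus[symmetric] simp del: ennreal_plus intro!: ennreal_leI)
  also have "\<dots> = (\<integral>\<^sup>+y\<in>ball x t. ennreal \<bar>v y - f y\<bar> \<partial>lebesgue) + (\<integral>\<^sup>+y\<in>ball x t. ennreal \<bar>w y - f y\<bar> \<partial>lebesgue)"
    by (rule nn_integral_add) measurable
  also have "(\<integral>\<^sup>+y\<in>ball x t. ennreal (norm (gradient v y - gradient w y)) \<partial>lebesgue) \<le>
      (\<integral>\<^sup>+y. ennreal (norm (gradient v y - G y)) * indicator (ball x t) y + ennreal (norm (gradient w y - G y)) * indicator (ball x t) y \<partial>lebesgue)"
  proof (intro nn_integral_mono)
    fix y
    have "norm (gradient v y - gradient w y) \<le> norm (gradient v y - G y) + norm (gradient w y - G y)"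
      using norm_triangle_ineq4[of "gradient v y - G y" "gradient w y - G y"] by simp
    then show "ennreal (norm (gradient v y - gradient w y)) * indicator (ball x t) y \<le>
      ennreal (norm (gradient v y - G y)) * indicator (ball x t) y + ennreal (norm (gradient w y - G y)) * indicator (ball x t) y"
      by (simp add: indicator_def ennreal_plus[symmetric] ennreal_leI del: ennreal_plus)
  qed
  also have "\<dots> = (\<integral>\<^sup>+y\<in>ball x t. ennreal (norm (gradient v y - G y)) \<partial>lebesgue) +
      (\<integral>\<^sup>+y\<in>ball x t. ennreal (norm (gradient w y - G y)) \<partial>lebesgue)"
    by (rule nn_integral_add) measurable
  also have "(\<integral>\<^sup>+y\<in>ball x t. ennreal (norm (gradient w y - G y)) \<partial>lebesgue) =
      (\<integral>\<^sup>+y\<in>ball x t. ennreal (norm (gradient w y - H y)) \<partial>lebesgue)"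
    by (rule nn_integral_cong_AE) (use H in eventually_elim, simp)
  finally show ?thesis by (simp add: mult_left_mono add_mono)
qed

lemma u_sphere_integrable: "t > 0 \<Longrightarrow> integrable (sphere_measure x t) (u k)"
  by (rule integrable_sphere_measure_continuous[OF _ smooth_continuous_on[OF u]])

section \<open>Existence of traces and convergence of sphere averages\<close>

lemma trace_exists:
  assumes t: "t > 0"
  shows "\<exists>h. has_trace_on_sphere f x t h"
proof -
  \<comment> \<open>From index \<open>N\<close> on, the ball around \<open>x\<close> lies where
    \<open>u k\<close> is controlled.\<close>
  obtain N :: nat where N: "norm x + t \<le> real N" using real_arch_simple by blast
  let ?M = "sphere_measure x t"
  \<comment> \<open>Two errors of at most 2^(-k) in the values, weighted by n / t, and two in the
    gradients.\<close>
  define C where "C = 2 * (DIM('a) / t + 1)"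
  have C: "C \<ge> 0" using t by (simp add: C_def)
  have "\<exists>h. integrable ?M h \<and> (\<lambda>k. \<integral>\<^sup>+y. ennreal \<bar>u (k + N) y - h y\<bar> \<partial>?M) \<longlonglongrightarrow> 0"
  proof (rule L1_limit_of_geometric_Cauchy[OF u_sphere_integrable[OF t] C])
    fix k
    let ?e = "(1 / 2) ^ k :: real"
    have le: "ennreal ((1 / 2) ^ j) \<le> ennreal ?e" if "j \<ge> k" for j
      by (intro ennreal_leI power_decreasing that) auto
    have N': "norm x + t \<le> real (Suc k + N)" "norm x + t \<le> real (k + N)" using N by auto
    have "(\<integral>\<^sup>+y. ennreal \<bar>u (Suc k + N) y - u (k + N) y\<bar> \<partial>?M) \<le>
        ennreal (DIM('a) / t) * (ennreal ?e + ennreal ?e) + (ennreal ?e + ennreal ?e)"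
      by (rule order_trans[OF sphere_diff_le[OF t u u AE_I2[OF refl]]])
        (intro add_mono mult_left_mono order_trans[OF ball_le(1)[OF N'(1)] le] order_trans[OF ball_le(1)[OF N'(2)] le]
          order_trans[OF ball_le(2)[OF N'(1)] le] order_trans[OF ball_le(2)[OF N'(2)] le]; simp)
    also have "\<dots> = ennreal (C * ?e)"
      using t by (simp add: C_def ennreal_plus[symmetric] ennreal_mult'[symmetric] algebra_simps del: ennreal_plus)
    finally show "(\<integral>\<^sup>+y. ennreal \<bar>u (Suc k + N) y - u (k + N) y\<bar> \<partial>?M) \<le> ennreal (C * ?e)" .
  qed
  then obtain h where h: "integrable ?M h" "(\<lambda>k. \<integral>\<^sup>+y. ennreal \<bar>u (k + N) y - h y\<bar> \<partial>?M) \<longlonglongrightarrow> 0"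
    by blast
  have "(\<lambda>k. \<integral>\<^sup>+y. ennreal \<bar>u k y - h y\<bar> \<partial>?M) \<longlonglongrightarrow> 0"
    using h(2) by (rule LIMSEQ_offset)
  then show ?thesis
    unfolding has_trace_on_sphere_def
    by (intro exI[of _ h] conjI exI[of _ G] exI[of _ u] allI G u h(1) ball_tendsto_0)
qed

text \<open>Makes the choice in \<open>sphere_trace\<close> harmless: \<open>h\<close> is arbitrary,
  with its own \<open>w\<close> and \<open>H\<close>. On the sphere \<open>u k\<close> is close to
  \<open>w k\<close> by the trace inequality, and \<open>w k\<close> to \<open>h\<close> by
  definition.\<close>

lemma trace_tendsto:
  assumes t: "t > 0" and h: "has_trace_on_sphere f x t h"
  shows "(\<lambda>k. LINT y|sphere_measure x t. u k y) \<longlonglongrightarrow> (LINT y|sphere_measure x t. h y)"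
proof -
  let ?M = "sphere_measure x t"
  from h have hi: "integrable ?M h" by (simp add: has_trace_on_sphere_def)
  from h obtain H w where H: "has_weak_gradient f H" and w: "\<forall>k. smooth (w k)"
    and lims: "(\<lambda>k. \<integral>\<^sup>+y\<in>ball x t. ennreal \<bar>w k y - f y\<bar> \<partial>lebesgue) \<longlonglongrightarrow> 0"
      "(\<lambda>k. \<integral>\<^sup>+y\<in>ball x t. ennreal (norm (gradient (w k) y - H y)) \<partial>lebesgue) \<longlonglongrightarrow> 0"
      "(\<lambda>k. \<integral>\<^sup>+y. ennreal \<bar>w k y - h y\<bar> \<partial>?M) \<longlonglongrightarrow> 0"
    unfolding has_trace_on_sphere_def by (elim conjE exE) (rule that)
  note w = w[rule_format]
  have [measurable]: "h \<in> borel_measurable borel"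
    using borel_measurable_integrable[OF hi] by (simp cong: measurable_cong_sets)
  have [measurable]: "w k \<in> borel_measurable borel" for k
    by (rule borel_measurable_continuous_onI[OF smooth_continuous_on[OF w]])
  define b where "b k = ennreal (DIM('a) / t) * ((\<integral>\<^sup>+y\<in>ball x t. ennreal \<bar>u k y - f y\<bar> \<partial>lebesgue) +
      (\<integral>\<^sup>+y\<in>ball x t. ennreal \<bar>w k y - f y\<bar> \<partial>lebesgue)) +
    ((\<integral>\<^sup>+y\<in>ball x t. ennreal (norm (gradient (u k) y - G y)) \<partial>lebesgue) +
      (\<integral>\<^sup>+y\<in>ball x t. ennreal (norm (gradient (w k) y - H y)) \<partial>lebesgue))" for k
  have "b \<longlonglongrightarrow> ennreal (DIM('a) / t) * (0 + 0) + (0 + 0)"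
    unfolding b_def by (intro tendsto_add ennreal_tendsto_cmult ball_tendsto_0 lims) simp
  from tendsto_add[OF this lims(3)]
  have b: "(\<lambda>k. b k + (\<integral>\<^sup>+y. ennreal \<bar>w k y - h y\<bar> \<partial>?M)) \<longlonglongrightarrow> 0" by simp
  have le: "(\<integral>\<^sup>+y. ennreal (norm (u k y - h y)) \<partial>?M) \<le> b k + (\<integral>\<^sup>+y. ennreal \<bar>w k y - h y\<bar> \<partial>?M)" for k
  proof -
    have "(\<integral>\<^sup>+y. ennreal (norm (u k y - h y)) \<partial>?M) \<le> (\<integral>\<^sup>+y. ennreal \<bar>u k y - w k y\<bar> + ennreal \<bar>w k y - h y\<bar> \<partial>?M)"
      by (intro nn_integral_mono) (auto simp: ennreal_plus[symmetric] simp del: ennreal_plus intro!: ennreal_leI)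
    also have "\<dots> = (\<integral>\<^sup>+y. ennreal \<bar>u k y - w k y\<bar> \<partial>?M) + (\<integral>\<^sup>+y. ennreal \<bar>w k y - h y\<bar> \<partial>?M)"
      by (rule nn_integral_add) measurable
    also have "(\<integral>\<^sup>+y. ennreal \<bar>u k y - w k y\<bar> \<partial>?M) \<le> b k"
      unfolding b_def by (rule sphere_diff_le[OF t u w weak_gradient_unique[OF f G H]])
    finally show ?thesis by (simp add: add_right_mono)
  qed
  have "(\<lambda>k. \<integral>\<^sup>+y. ennreal (norm (u k y - h y)) \<partial>?M) \<longlonglongrightarrow> 0"
    by (rule tendsto_sandwich[OF _ always_eventually[OF allI[OF le]] tendsto_const b]) simp
  then show ?thesis
    by (rule tendsto_L1_int[OF u_sphere_integrable[OF t] hi])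
qed

lemma sphere_average_tendsto:
  assumes t: "t > 0"
  shows "(\<lambda>k. (LINT y|sphere_measure x t. u k y) / measure (sphere_measure x t) UNIV) \<longlonglongrightarrow> sphere_average f x t"
  unfolding sphere_average_def
proof (intro tendsto_divide tendsto_const trace_tendsto[OF t])
  show "has_trace_on_sphere f x t (sphere_trace f x t)"
    unfolding sphere_trace_def using trace_exists[OF t] by (rule someI_ex)
  show "measure (sphere_measure x t) UNIV \<noteq> 0"
    using t content_ball_pos[of 1 "0::'a"] by (simp add: measure_sphere_measure)
qed

text \<open>The cut-off errors have a summable total integral, so their series is finite almost
  everywhere and its terms tend to 0; at a fixed point the cutoff is eventually 1.\<close>

lemma AE_u_tendsto: "AE x in lebesgue. (\<lambda>k. u k x) \<longlonglongrightarrow> f x"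
proof -
  have meas: "(\<lambda>x. ennreal \<bar>u k x - f x\<bar> * indicator (ball 0 (real k)) x) \<in> borel_measurable lebesgue" for k
    by measurable
  have "(\<integral>\<^sup>+x. (\<Sum>k. ennreal \<bar>u k x - f x\<bar> * indicator (ball 0 (real k)) x) \<partial>lebesgue) \<le> (\<Sum>k. ennreal ((1 / 2) ^ k))"
    unfolding nn_integral_suminf[OF meas] by (intro suminf_le u_le) auto
  also have "\<dots> = ennreal 2"
    by (rule suminf_ennreal_eq) (use geometric_sums[of "1 / 2 :: real"] in auto)
  finally have "AE x in lebesgue. (\<Sum>k. ennreal \<bar>u k x - f x\<bar> * indicator (ball 0 (real k)) x) \<noteq> \<infinity>"
    by (intro nn_integral_PInf_AE borel_measurable_suminf_order meas) (auto simp: top_unique)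
  then show ?thesis
  proof eventually_elim
    case (elim x)
    then have "summable (\<lambda>k. \<bar>u k x - f x\<bar> * indicator (ball 0 (real k)) x)"
      by (intro summable_suminf_not_top) (simp_all add: ennreal_mult ennreal_indicator)
    then have lim: "(\<lambda>k. \<bar>u k x - f x\<bar> * indicator (ball 0 (real k)) x) \<longlonglongrightarrow> 0" by (rule summable_LIMSEQ_zero)
    obtain N :: nat where "norm x < N" using reals_Archimedean2 by blast
    then have "\<forall>\<^sub>F k in sequentially. \<bar>u k x - f x\<bar> * indicator (ball 0 (real k)) x = \<bar>u k x - f x\<bar>"
      unfolding eventually_sequentially by (intro exI[of _ N]) auto
    with lim have "(\<lambda>k. \<bar>u k x - f x\<bar>) \<longlonglongrightarrow> 0" by (rule Lim_transform_eventually)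
    then show ?case by (rule LIM_zero_cancel[OF tendsto_rabs_zero_cancel])
  qed
qed

section \<open>The kernel integral at good points\<close>

lemma riesz_inner_measurable: "(\<lambda>y. riesz y \<bullet> G (x - y)) \<in> borel_measurable lebesgue"
proof (rule borel_measurable_inner)
  show "riesz \<in> borel_measurable lebesgue" by (rule measurable_completion) simp
  show "(\<lambda>y. G (x - y)) \<in> borel_measurable lebesgue"
    by (rule borel_measurable_lebesgue_reflect[OF measurability(2)])
qed

text \<open>A condition on \<open>x\<close> that does not mention \<open>t\<close>, so that a single null set serves all radii.\<close>

definition good_point :: "'a \<Rightarrow> bool" where
  "good_point x \<longleftrightarrow> (\<forall>R::nat. (\<Sum>k. \<integral>\<^sup>+y. (ennreal (norm (riesz y)) * indicator (ball 0 (real (Suc R))) y) *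
      (ennreal (norm (gradient (u k) (x - y) - G (x - y))) * indicator (ball 0 (real k)) (x - y)) \<partial>lebesgue) < \<infinity>)"

text \<open>By Tonelli the integral of each convolution is the finite kernel mass times an error
  mass of at most 2^(-k). The sum of the convolutions is thus integrable, hence finite almost
  everywhere, and countably many radii keep the exceptional set null.\<close>

lemma AE_good_point: "AE x in lebesgue. good_point x"
proof -
  define E where "E k y = ennreal (norm (gradient (u k) y - G y)) * indicator (ball 0 (real k)) y" for k y
  have E [measurable]: "E k \<in> borel_measurable lebesgue" for k unfolding E_def by measurable
  \<comment> \<open>The radius \<open>Suc R\<close> is positive also for \<open>R = 0\<close>, as
    \<open>nn_integral_riesz_finite\<close> requires.\<close>
  define \<kappa> where "\<kappa> R y = ennreal (norm (riesz y)) * indicator (ball 0 (real (Suc R))) y" for R :: nat and y :: 'a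
  have \<kappa> [measurable]: "\<kappa> R \<in> borel_measurable borel" for R unfolding \<kappa>_def by measurable
  have "AE x in lebesgue. (\<Sum>k. \<integral>\<^sup>+y. \<kappa> R y * E k (x - y) \<partial>lebesgue) < \<infinity>" for R
  proof -
    let ?c = "\<lambda>k x. \<integral>\<^sup>+y. \<kappa> R (x - y) * E k y \<partial>lebesgue"
    have meas: "?c k \<in> borel_measurable lebesgue" for k
      by (rule measurable_completion) (use nn_integral_convolution(1)[OF E \<kappa>] in simp)
    have \<kappa>_fin: "(\<integral>\<^sup>+y. \<kappa> R y \<partial>lborel) < \<infinity>"
      unfolding \<kappa>_def by (rule nn_integral_riesz_finite) simp
    have "(\<integral>\<^sup>+x. (\<Sum>k. ?c k x) \<partial>lebesgue) = (\<Sum>k. (\<integral>\<^sup>+y. \<kappa> R y \<partial>lborel) * (\<integral>\<^sup>+y. E k y \<partial>lebesgue))"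
      unfolding nn_integral_suminf[OF meas] nn_integral_convolution(2)[OF E \<kappa>] ..
    also have "\<dots> = (\<integral>\<^sup>+y. \<kappa> R y \<partial>lborel) * (\<Sum>k. \<integral>\<^sup>+y. E k y \<partial>lebesgue)"
      by simp
    also have "(\<Sum>k. \<integral>\<^sup>+y. E k y \<partial>lebesgue) \<le> (\<Sum>k. ennreal ((1 / 2) ^ k))"
      unfolding E_def by (intro suminf_le grad_le) auto
    also have "(\<Sum>k. ennreal ((1 / 2) ^ k)) = ennreal 2"
      by (rule suminf_ennreal_eq) (use geometric_sums[of "1 / 2 :: real"] in auto)
    finally have "(\<integral>\<^sup>+x. (\<Sum>k. ?c k x) \<partial>lebesgue) \<le> (\<integral>\<^sup>+y. \<kappa> R y \<partial>lborel) * ennreal 2"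
      by (simp add: mult_left_mono)
    also have "\<dots> < \<infinity>" using \<kappa>_fin by (simp add: ennreal_mult_less_top)
    finally have "AE x in lebesgue. (\<Sum>k. ?c k x) \<noteq> \<infinity>"
      by (intro nn_integral_PInf_AE borel_measurable_suminf_order meas) auto
    then show ?thesis
      unfolding nn_integral_convolution(3)[OF E \<kappa>] by eventually_elim (simp add: less_top)
  qed
  then show ?thesis
    unfolding good_point_def \<kappa>_def E_def by (subst AE_all_countable) blast
qed

text \<open>At a good point the kernel-weighted gradient errors are terms of a convergent series,
  hence tend to 0. Some ball of integer radius in \<open>good_point\<close> contains the ball of
  radius \<open>t\<close>, whatever the real \<open>t\<close>.\<close>

lemma kernel_tendsto:
  assumes x: "good_point x" and t: "t > 0"
  shows "integrable lebesgue (\<lambda>y. indicator (ball 0 t) y * (riesz y \<bullet> G (x - y)))"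
    and "(\<lambda>k. LINT y|lebesgue. indicator (ball 0 t) y * (riesz y \<bullet> gradient (u k) (x - y))) \<longlonglongrightarrow>
      (LINT y|lebesgue. indicator (ball 0 t) y * (riesz y \<bullet> G (x - y)))"
proof -
  let ?g = "\<lambda>y. indicator (ball 0 t) y * (riesz y \<bullet> G (x - y))"
  let ?v = "\<lambda>k y. indicator (ball 0 t) y * (riesz y \<bullet> gradient (u k) (x - y))"
  have gm: "?g \<in> borel_measurable lebesgue"
    by (intro borel_measurable_times borel_measurable_indicator ball_lebesgue riesz_inner_measurable)
  have vi: "integrable lebesgue (?v k)" for k
  proof -
    have "integrable lborel (?v k)"
      by (intro integrable_riesz_continuous t continuous_on_compose2[OF continuous_on_gradient[OF u, of UNIV]]
          continuous_intros) simp
    then show ?thesis by (simp add: integrable_completion)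
  qed
  obtain R :: nat where "t \<le> real R" using real_arch_simple by blast
  then have R: "t \<le> real (Suc R)" by simp
  \<comment> \<open>From index \<open>N\<close> on, the cutoff equals 1 at every x - y with |y| <
    t.\<close>
  obtain N :: nat where N: "norm x + t \<le> real N" using real_arch_simple by blast
  define c where "c k = (\<integral>\<^sup>+y. (ennreal (norm (riesz y)) * indicator (ball 0 (real (Suc R))) y) *
      (ennreal (norm (gradient (u k) (x - y) - G (x - y))) * indicator (ball 0 (real k)) (x - y)) \<partial>lebesgue)" for k
  have fin: "(\<Sum>k. c k) < \<infinity>" using x unfolding good_point_def c_def by blast
  have c_fin: "c k < \<infinity>" for k
    using fin sum_le_suminf[OF summableI, of "{k}" c] by (auto intro: le_less_trans)
  have "c \<longlonglongrightarrow> 0"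
  proof -
    have c_eq: "c k = ennreal (enn2real (c k))" for k using c_fin[of k] by (simp add: less_top)
    have "summable (\<lambda>k. enn2real (c k))"
      using fin by (intro summable_suminf_not_top) (simp_all add: c_eq[symmetric] less_top)
    then have "(\<lambda>k. ennreal (enn2real (c k))) \<longlonglongrightarrow> ennreal 0"
      by (intro tendsto_ennrealI summable_LIMSEQ_zero)
    then show ?thesis by (simp only: c_eq[symmetric] ennreal_0)
  qed
  then have c0: "(\<lambda>k. c (k + N)) \<longlonglongrightarrow> 0" by (rule LIMSEQ_ignore_initial_segment)
  have le: "(\<integral>\<^sup>+y. ennreal (norm (?v (k + N) y - ?g y)) \<partial>lebesgue) \<le> c (k + N)" for k
    unfolding c_def
  proof (intro nn_integral_mono)
    fix y :: 'a
    let ?D = "gradient (u (k + N)) (x - y) - G (x - y)"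
    show "ennreal (norm (?v (k + N) y - ?g y)) \<le> (ennreal (norm (riesz y)) * indicator (ball 0 (real (Suc R))) y) *
      (ennreal (norm ?D) * indicator (ball 0 (real (k + N))) (x - y))"
    proof (cases "norm y < t")
      case True
      have "norm (x - y) < real (k + N)" using True N norm_triangle_ineq4[of x y] by simp
      moreover have "norm y < real (Suc R)" using True R by simp
      moreover have "\<bar>riesz y \<bullet> ?D\<bar> \<le> norm (riesz y) * norm ?D" by (rule Cauchy_Schwarz_ineq2)
      ultimately show ?thesis using True
        by (simp add: inner_diff_right ennreal_mult'[symmetric] ennreal_leI)
    qed simp
  qed
  \<comment> \<open>The limit integrand is integrable as the smooth one of index \<open>N\<close>
    minus this difference.\<close>
  have "integrable lebesgue (\<lambda>y. ?v N y - ?g y)"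
  proof (rule integrableI_bounded)
    show "(\<lambda>y. ?v N y - ?g y) \<in> borel_measurable lebesgue"
      by (intro borel_measurable_diff borel_measurable_integrable[OF vi] gm)
    show "(\<integral>\<^sup>+y. ennreal (norm (?v N y - ?g y)) \<partial>lebesgue) < \<infinity>"
      using le[of 0] c_fin[of N] by simp
  qed
  from Bochner_Integration.integrable_diff[OF vi[of N] this]
  show gi: "integrable lebesgue ?g" by simp
  have "(\<lambda>k. \<integral>\<^sup>+y. ennreal (norm (?v (k + N) y - ?g y)) \<partial>lebesgue) \<longlonglongrightarrow> 0"
    by (rule tendsto_sandwich[OF _ always_eventually[OF allI[OF le]] tendsto_const c0]) simp
  then have "(\<lambda>k. LINT y|lebesgue. ?v (k + N) y) \<longlonglongrightarrow> (LINT y|lebesgue. ?g y)"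
    by (rule tendsto_L1_int[OF vi gi])
  then show "(\<lambda>k. LINT y|lebesgue. ?v k y) \<longlonglongrightarrow> (LINT y|lebesgue. ?g y)"
    by (rule LIMSEQ_offset)
qed

text \<open>The substitution z = -y in \<open>sphere_mean_smooth\<close>; the kernel is odd, which
  turns the difference around.\<close>

lemma smooth_minus_sphere_mean:
  assumes t: "t > 0"
  shows "u k x - (LINT y|sphere_measure x t. u k y) / measure (sphere_measure x t) UNIV =
    1 / (DIM('a) * measure lborel (ball (0::'a) 1)) *
      (LINT y|lebesgue. indicator (ball 0 t) y * (riesz y \<bullet> gradient (u k) (x - y)))"
proof -
  let ?F = "\<lambda>z. indicator (ball 0 t) z * (riesz z \<bullet> gradient (u k) (x + z))"
  have "(LINT z|lborel. ?F z) = (LINT y|lborel. ?F (- y))"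
    by (subst lborel_affine[of "-1" 0]) (simp_all add: density_1 integral_distr)
  also have "\<dots> = (LINT y|lborel. - (indicator (ball 0 t) y * (riesz y \<bullet> gradient (u k) (x - y))))"
    by (intro Bochner_Integration.integral_cong) (auto simp: riesz_uminus indicator_def)
  also have "\<dots> = - (LINT y|lebesgue. indicator (ball 0 t) y * (riesz y \<bullet> gradient (u k) (x - y)))"
    by (simp add: integral_completion)
  finally show ?thesis
    using sphere_mean_smooth[OF u[of k] t, of x] by (simp add: algebra_simps)
qed

lemma minus_sphere_average:
  assumes x: "good_point x" and lim: "(\<lambda>k. u k x) \<longlonglongrightarrow> f x" and t: "t > 0"
  shows "f x - sphere_average f x t = 1 / (DIM('a) * measure lborel (ball (0::'a) 1)) *
    (LINT y|lebesgue. indicator (ball 0 t) y * (riesz y \<bullet> G (x - y)))"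
proof (rule LIMSEQ_unique)
  show "(\<lambda>k. u k x - (LINT y|sphere_measure x t. u k y) / measure (sphere_measure x t) UNIV) \<longlonglongrightarrow>
      f x - sphere_average f x t"
    by (intro tendsto_diff lim sphere_average_tendsto t)
  show "(\<lambda>k. u k x - (LINT y|sphere_measure x t. u k y) / measure (sphere_measure x t) UNIV) \<longlonglongrightarrow>
      1 / (DIM('a) * measure lborel (ball (0::'a) 1)) *
      (LINT y|lebesgue. indicator (ball 0 t) y * (riesz y \<bullet> G (x - y)))"
    unfolding smooth_minus_sphere_mean[OF t] by (intro tendsto_mult_left kernel_tendsto(2) x t)
qed

end

lemma fast_smooth_approximation_exists:
  fixes f :: "'a::euclidean_space \<Rightarrow> real"
  assumes f: "locally_integrable f" and G: "has_weak_gradient f G"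
  shows "\<exists>u. fast_smooth_approximation f G u"
proof -
  have "\<forall>k. \<exists>u. smooth u \<and> (\<integral>\<^sup>+x\<in>ball 0 (real k). ennreal \<bar>u x - f x\<bar> \<partial>lebesgue) \<le> ennreal ((1 / 2) ^ k) \<and>
    (\<integral>\<^sup>+x\<in>ball 0 (real k). ennreal (norm (gradient u x - G x)) \<partial>lebesgue) \<le> ennreal ((1 / 2) ^ k)"
    by (intro allI smooth_approximation[OF f G]) simp
  then obtain u where "\<forall>k. smooth (u k) \<and> (\<integral>\<^sup>+x\<in>ball 0 (real k). ennreal \<bar>u k x - f x\<bar> \<partial>lebesgue) \<le> ennreal ((1 / 2) ^ k) \<and>
    (\<integral>\<^sup>+x\<in>ball 0 (real k). ennreal (norm (gradient (u k) x - G x)) \<partial>lebesgue) \<le> ennreal ((1 / 2) ^ k)"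
    by (rule choice[THEN exE])
  then have "fast_smooth_approximation f G u"
    using f G by unfold_locales auto
  then show ?thesis by blast
qed

text \<open>At a good point where \<open>u k x\<close> converges to \<open>f x\<close>, all three
  square functions are built from one kernel integral, for every t > 0. Integrability is asserted as
  well because a Bochner integral is 0 by convention when it fails.\<close>

theorem lemma1p5:
  fixes f :: "'a::euclidean_space \<Rightarrow> real" and grad_f :: "'a \<Rightarrow> 'a"
  assumes "f \<in> W11_loc" and "has_weak_gradient f grad_f"
  shows "AE x in lebesgue.
    (\<forall>t>0. integrable lebesgue (\<lambda>y. dilate phi t y \<bullet> grad_f (x - y))) \<and>
    square_fun f x =
      ennreal_sqrt (\<integral>\<^sup>+t\<in>{0<..}. ennreal (\<bar>inner_convolution (dilate phi t) grad_f x\<bar>\<^sup>2 / t) \<partial>lborel) \<and>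
    ennreal_sqrt (\<integral>\<^sup>+t\<in>{0<..}. ennreal (\<bar>inner_convolution (dilate phi t) grad_f x\<bar>\<^sup>2 / t) \<partial>lborel) =
      ennreal (1 / (real DIM('a) * measure lborel (ball (0::'a) 1))) *
      ennreal_sqrt (\<integral>\<^sup>+t\<in>{0<..}. ennreal
        (\<bar>LINT y:cball 0 t|lebesgue. ((1 / norm y ^ DIM('a)) *\<^sub>R y) \<bullet> grad_f (x - y)\<bar>\<^sup>2 / t ^ 3) \<partial>lborel)"
proof -
  have f: "locally_integrable f" using assms(1) by (simp add: W11_loc_def)
  obtain u where "fast_smooth_approximation f grad_f u"
    using fast_smooth_approximation_exists[OF f assms(2)] by blast
  then interpret fast_smooth_approximation f grad_f u .
  define c where "c = 1 / (real DIM('a) * measure lborel (ball (0::'a) 1))"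
  have c: "c > 0" using content_ball_pos[of 1 "0::'a"] by (simp add: c_def)
  show ?thesis
    unfolding c_def[symmetric] using AE_good_point AE_u_tendsto
  proof eventually_elim
    case (elim x)
    let ?k = "\<lambda>t y. indicator (ball 0 t) y * (riesz y \<bullet> grad_f (x - y))"
    define I where "I t = (LINT y|lebesgue. ?k t y)" for t
    have dil: "dilate phi t y \<bullet> grad_f (x - y) = c / t * ?k t y" if "t > 0" for t y
      by (simp add: dilate_phi[OF that] c_def mult.commute)
    have conv: "inner_convolution (dilate phi t) grad_f x = c / t * I t" if t: "t > 0" for t
      unfolding inner_convolution_def dil[OF t] I_def by (rule integral_mult_right_zero)
    have avg: "f x - sphere_average f x t = c * I t" if t: "t > 0" for t
      using minus_sphere_average[OF elim t] by (simp add: c_def I_def)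
    \<comment> \<open>Closed and open ball differ by a null sphere.\<close>
    have set: "(LINT y:cball 0 t|lebesgue. ((1 / norm y ^ DIM('a)) *\<^sub>R y) \<bullet> grad_f (x - y)) = I t" for t
      unfolding I_def set_lebesgue_integral_def riesz_def[symmetric]
    proof (rule integral_cong_AE)
      have "AE y in lebesgue. y \<notin> sphere (0::'a) t"
        using negligible_sphere[of "0::'a" t] by (simp add: negligible_iff_null_sets AE_not_in del: mem_sphere mem_sphere_0)
      then show "AE y in lebesgue. indicator (cball 0 t) y *\<^sub>R (riesz y \<bullet> grad_f (x - y)) = ?k t y"
        by eventually_elim (auto simp: indicator_def)
    qed (intro borel_measurable_scaleR borel_measurable_times borel_measurable_indicator
        riesz_inner_measurable ball_lebesgue; simp)+
    have int: "\<forall>t>0. integrable lebesgue (\<lambda>y. dilate phi t y \<bullet> grad_f (x - y))"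
      using kernel_tendsto(1)[OF elim(1)] by (auto simp: dil)
    \<comment> \<open>The integrands agree for each t > 0, as (c I)^2 / t^3 = (c I / t)^2 / t; no
      measurability in t is involved.\<close>
    have sq: "(\<integral>\<^sup>+t\<in>{0<..}. ennreal (\<bar>f x - sphere_average f x t\<bar>\<^sup>2 / t ^ 3) \<partial>lborel) =
        (\<integral>\<^sup>+t\<in>{0<..}. ennreal (\<bar>inner_convolution (dilate phi t) grad_f x\<bar>\<^sup>2 / t) \<partial>lborel)"
    proof (rule nn_integral_cong)
      fix t :: real
      have "\<bar>f x - sphere_average f x t\<bar>\<^sup>2 / t ^ 3 = \<bar>inner_convolution (dilate phi t) grad_f x\<bar>\<^sup>2 / t" if t: "t > 0"
        unfolding avg[OF t] conv[OF t] using t by (simp add: power_mult_distrib power_divide power2_eq_square power3_eq_cube)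
      then show "ennreal (\<bar>f x - sphere_average f x t\<bar>\<^sup>2 / t ^ 3) * indicator {0<..} t =
          ennreal (\<bar>inner_convolution (dilate phi t) grad_f x\<bar>\<^sup>2 / t) * indicator {0<..} t"
        by (simp add: indicator_def)
    qed
    have "(\<integral>\<^sup>+t\<in>{0<..}. ennreal (\<bar>inner_convolution (dilate phi t) grad_f x\<bar>\<^sup>2 / t) \<partial>lborel) =
        (\<integral>\<^sup>+t. ennreal (c\<^sup>2) * (ennreal (\<bar>I t\<bar>\<^sup>2 / t ^ 3) * indicator {0<..} t) \<partial>lborel)"
    proof (rule nn_integral_cong)
      fix t :: real
      have "\<bar>inner_convolution (dilate phi t) grad_f x\<bar>\<^sup>2 / t = c\<^sup>2 * (\<bar>I t\<bar>\<^sup>2 / t ^ 3)" if t: "t > 0"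
        unfolding conv[OF t] using t by (simp add: power_mult_distrib power_divide power2_eq_square power3_eq_cube)
      then show "ennreal (\<bar>inner_convolution (dilate phi t) grad_f x\<bar>\<^sup>2 / t) * indicator {0<..} t =
          ennreal (c\<^sup>2) * (ennreal (\<bar>I t\<bar>\<^sup>2 / t ^ 3) * indicator {0<..} t)"
        by (simp add: indicator_def ennreal_mult'[symmetric])
    qed
    also have "\<dots> = ennreal (c\<^sup>2) * (\<integral>\<^sup>+t\<in>{0<..}. ennreal (\<bar>I t\<bar>\<^sup>2 / t ^ 3) \<partial>lborel)"
      by (rule nn_integral_cmult_nonmeasurable) (use c in simp)
    finally show ?case
      unfolding square_fun_def sq set using int c by (simp add: ennreal_sqrt_mult_square)
  qed
qed

end
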